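(* A locally valid program satisfies the FS guard condition.
   Context: Setting: session-typed processes for subsingleton logic with least and greatest fixed points. A signature $\Sigma$ defines type variables $t =^{i}_{a} A$ with priority $i$ (1 is the highest priority, $n$ the lowest) and polarity $a\in\{\mu,\nu\}$ (positive/least or negative/greatest fixed point). A program $\mathcal{P}=\langle V,S\rangle$ consists of a finite set $V$ of process definitions $\bar{x}:\omega \vdash X = P_{\bar{x},y} :: (y:C)$ and a main process variable $S$. Processes are typed in an infinitary system where channels carry generations $x^\alpha$ and a set $\Omega$ of (in)equalities between channel generations indexed by priorities is accumulated: receiving a $\mu_t$ unfolding on the left (rule $\mu L$) or a $\nu_t$ unfolding on the right (rule $\nu R$) records that the next generation is strictly smaller at priority $p(t)$ and equal at other priorities; sending an unfolding ($\mu R$, $\nu L$) records equality only at priorities other than $p(t)$; a process call is typed by unfolding its definition (rule Def). Local validity: fix a family of disjoint partial orders $\{\subseteq_i\}_{0\le i\le n}$ whose domains partition $V$, with induced order $\subset$ on process variables. For a process with left channel $\bar{x}$ and right channel $y$, $list(\bar{x},y)=[f_i]_{i\le n}$ with $f_i=(\bar{x}_i,y_i)$ if priority $i$ is positive and $f_i=(y_i,\bar{x}_i)$ if it is negative; this is compared lexicographically, combined with $\subset$ into a strict order $(\subset,<)$. The program is locally valid iff for every definition $\bar{z}:\omega\vdash X=P_{\bar{z},w}::(w:C)\in V$ there is a derivation of $\langle\bar{z}^0,X,w^0\rangle;\bar{z}^0:\omega\vdash_{\emptyset,\subset}P_{\bar{z}^0,w^0}::(w^0:C)$ in a finitary rule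 system whose Call rule, at each call $w^\beta\leftarrow Y\leftarrow\bar{z}^\alpha$, requires $Y,list(\bar{z}^\alpha,w^\beta)\ (\subset,<_\Omega)\ X,list(\bar{u}^\gamma,v^\delta)$, where $X,\bar{u}^\gamma,v^\delta$ are the process variable and channels the check started from. FS guard condition (Fortier–Santocanale): a cycle is a path in the infinitary typing derivation from a judgment $\bar{z}^\alpha:\omega\vdash_\Omega w^\beta\leftarrow X\leftarrow\bar{z}^\alpha::(w^\beta:C)$ up to a judgment $\bar{x}^\gamma:\omega'\vdash_{\Omega'} y^\delta\leftarrow X\leftarrow\bar{x}^\gamma::(y^\delta:C')$ for the same process variable $X$. It is a left $\mu$-trace if it is left traceable ($\bar{z},\bar{x}$ nonempty and $\bar{z}=\bar{x}$), some left fixed point rule is applied on it, and the highest priority of the left fixed point rules applied on it is positive ($\mu$); dually it is a right $\nu$-trace if it is right traceable ($w=y$), some right fixed point rule is applied, and the highest priority of right fixed point rules applied is negative ($\nu$). A program satisfies the FS guard condition if every cycle over it is a left $\mu$-trace or a right $\nu$-trace. *)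

theory Defs
  imports Main "HOL-Library.FSet" "HOL-Library.Finite_Map"
begin

datatype polarity = Mu | Nu

text \<open>
  Labels are of type \<open>'l\<close>, type variables of type \<open>'t\<close>.  The finite label set of an internal or
  external choice is the domain of the finite map.
\<close>

datatype (dead 'l, tvars: 't) tp =
    One
  | Plus "('l, ('l, 't) tp) fmap"
  | With "('l, ('l, 't) tp) fmap"
  | TVar 't

text \<open>\<open>\<Sigma> t = Some (i, a, A)\<close> stands for the definition of \<open>t\<close> as a fixed point \<open>A\<close> with
  priority \<open>i\<close> and polarity \<open>a\<close>.\<close>

type_synonym ('l, 't) sig = "'t \<rightharpoonup> nat \<times> polarity \<times> ('l, 't) tp"

definition wf_sig :: "('l, 't) sig \<Rightarrow> bool" where
  "wf_sig \<Sigma> \<longleftrightarrow>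
     finite (dom \<Sigma>) \<and>
     (\<forall>t i a A. \<Sigma> t = Some (i, a, A) \<longrightarrow> 1 \<le> i \<and> tvars A \<subseteq> dom \<Sigma>) \<and>
     (\<forall>t s i a b A B. \<Sigma> t = Some (i, a, A) \<longrightarrow> \<Sigma> s = Some (i, b, B) \<longrightarrow> a = b)"

definition prio :: "('l, 't) sig \<Rightarrow> 't \<Rightarrow> nat" where
  "prio \<Sigma> t = fst (the (\<Sigma> t))"

text \<open>Priority 1 is the highest one; the lowest priority \<open>n\<close> is the numerically largest.\<close>

definition lowest :: "('l, 't) sig \<Rightarrow> nat" where
  "lowest \<Sigma> = Max (insert 0 (prio \<Sigma> ` dom \<Sigma>))"

definition has_polarity :: "('l, 't) sig \<Rightarrow> nat \<Rightarrow> polarity \<Rightarrow> bool" where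
  "has_polarity \<Sigma> i a \<longleftrightarrow> (\<exists>t A. \<Sigma> t = Some (i, a, A))"

text \<open>
  \<open>dep \<Sigma> A i\<close>: some type variable of priority \<open>i\<close> can be reached from \<open>A\<close> by unfolding
  definitions, i.e. \<open>i\<close> belongs to the set \<open>c(A)\<close> of priorities on which \<open>A\<close> depends.
\<close>

inductive dep :: "('l, 't) sig \<Rightarrow> ('l, 't) tp \<Rightarrow> nat \<Rightarrow> bool" for \<Sigma> where
  "fmlookup As l = Some A \<Longrightarrow> dep \<Sigma> A i \<Longrightarrow> dep \<Sigma> (Plus As) i"
| "fmlookup As l = Some A \<Longrightarrow> dep \<Sigma> A i \<Longrightarrow> dep \<Sigma> (With As) i"
| "\<Sigma> t = Some (i, a, A) \<Longrightarrow> dep \<Sigma> (TVar t) i"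
| "\<Sigma> t = Some (j, a, A) \<Longrightarrow> dep \<Sigma> A i \<Longrightarrow> dep \<Sigma> (TVar t) i"

text \<open>
  A subsingleton process has at most one left channel and exactly one right channel, so a
  reference to a channel in a process term is determined by its side and the terms need not
  contain channel names: for instance \<open>CaseLMu t P\<close> is
  \<open>case L x (\<mu>\<^sub>t \<Rightarrow> P)\<close> and \<open>Call X\<close> is \<open>y \<leftarrow> X \<leftarrow> x\<close>, where \<open>x\<close>
  and \<open>y\<close> are the left and right channel of the judgment the process occurs in.  In
  \<open>Cut P Q\<close>, i.e. \<open>w \<leftarrow> P ; Q\<close>, the bound channel \<open>w\<close> is the right channel of \<open>P\<close> and
  the left channel of \<open>Q\<close>.  Channel names and their generations live in the judgments.
\<close>

datatype (dead 'l, 't, 'x) proc =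
    Fwd
  | Cut "('l, 't, 'x) proc" "('l, 't, 'x) proc"
  | SendR 'l "('l, 't, 'x) proc"
  | CaseL "('l, ('l, 't, 'x) proc) fmap"
  | CaseR "('l, ('l, 't, 'x) proc) fmap"
  | SendL 'l "('l, 't, 'x) proc"
  | CloseR
  | WaitL "('l, 't, 'x) proc"
  | SendRMu 't "('l, 't, 'x) proc"
  | CaseLMu 't "('l, 't, 'x) proc"
  | CaseRNu 't "('l, 't, 'x) proc"
  | SendLNu 't "('l, 't, 'x) proc"
  | Call 'x

type_synonym chan = nat

text \<open>A definition \<open>x : \<omega> \<turnstile> X = P :: (y : C)\<close>; the left side is \<open>None\<close> if \<open>x\<close> and \<open>\<omega>\<close>
  are empty.\<close>

datatype ('l, 't, 'x) pdef =
  PDef (pleft: "(chan \<times> ('l, 't) tp) option") (pname: 'x) (pbody: "('l, 't, 'x) proc")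
       (pright: "chan \<times> ('l, 't) tp")

type_synonym ('l, 't, 'x) program = "('l, 't, 'x) pdef set \<times> 'x"

definition wf_program :: "('l, 't) sig \<Rightarrow> ('l, 't, 'x) program \<Rightarrow> bool" where
  "wf_program \<Sigma> \<P> \<longleftrightarrow> (case \<P> of (V, S) \<Rightarrow>
     finite V \<and> inj_on pname V \<and> S \<in> pname ` V \<and>
     (\<forall>d\<in>V. tvars (snd (pright d)) \<subseteq> dom \<Sigma> \<and>
        (\<forall>x A. pleft d = Some (x, A) \<longrightarrow> tvars A \<subseteq> dom \<Sigma> \<and> x \<noteq> fst (pright d))))"

text \<open>\<open>(x, \<alpha>)\<close> is the generation \<open>\<alpha>\<close> of the channel \<open>x\<close>; \<open>Less i a b\<close> and \<open>Equal i a b\<close> are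
  the constraints \<open>a\<^sub>i < b\<^sub>i\<close> and \<open>a\<^sub>i = b\<^sub>i\<close>.\<close>

type_synonym gchan = "chan \<times> nat"

datatype constr = Less nat gchan gchan | Equal nat gchan gchan

fun constr_chans :: "constr \<Rightarrow> chan set" where
  "constr_chans (Less i a b) = {fst a, fst b}"
| "constr_chans (Equal i a b) = {fst a, fst b}"

definition ch_eq :: "constr set \<Rightarrow> nat \<Rightarrow> gchan \<Rightarrow> gchan \<Rightarrow> bool" where
  "ch_eq \<Omega> i = equivclp (\<lambda>a b. Equal i a b \<in> \<Omega>)"

inductive ch_less :: "constr set \<Rightarrow> nat \<Rightarrow> gchan \<Rightarrow> gchan \<Rightarrow> bool" for \<Omega> i where
  "ch_eq \<Omega> i a a' \<Longrightarrow> Less i a' b' \<in> \<Omega> \<Longrightarrow> ch_eq \<Omega> i b' b \<Longrightarrow> ch_less \<Omega> i a b"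
| "ch_less \<Omega> i a b \<Longrightarrow> ch_less \<Omega> i b c \<Longrightarrow> ch_less \<Omega> i a c"

definition eq_other :: "('l, 't) sig \<Rightarrow> nat \<Rightarrow> gchan \<Rightarrow> gchan \<Rightarrow> constr set" where
  "eq_other \<Sigma> p a b = {Equal i a b | i. i \<in> {1..lowest \<Sigma>} \<and> i \<noteq> p}"

text \<open>
  The constraints \<open>r(v)\<close> of the cut rule: the new channel \<open>w\<close> of type \<open>A\<close> is identified with
  the channel \<open>v\<close> whose place it takes at all priorities on which \<open>A\<close> does not depend.
\<close>

definition cut_link :: "('l, 't) sig \<Rightarrow> ('l, 't) tp \<Rightarrow> gchan \<Rightarrow> gchan option \<Rightarrow> constr set" where
  "cut_link \<Sigma> A w v = {Equal i w a | i a. v = Some a \<and> i \<in> {1..lowest \<Sigma>} \<and> \<not> dep \<Sigma> A i}"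

datatype ('l, 't, 'x) jdg =
  Jdg (jleft: "(gchan \<times> ('l, 't) tp) option") (jrels: "constr set")
      (jproc: "('l, 't, 'x) proc") (jright: "gchan \<times> ('l, 't) tp")

definition jdg_chans :: "('l, 't, 'x) jdg \<Rightarrow> chan set" where
  "jdg_chans J = \<Union> (constr_chans ` jrels J) \<union> fst ` fst ` (set_option (jleft J) \<union> {jright J})"

datatype ('t, 'x) rule_name =
    RId | RCut | RPlusR | RPlusL | RWithR | RWithL | ROneR | ROneL
  | RMuR 't | RMuL 't | RNuR 't | RNuL 't | RDef 'x

text \<open>
  The rules common to the infinitary and to the finitary system, i.e. all but the one for
  process calls: \<open>rule_inst \<Sigma> N r Js J\<close> says that \<open>J\<close> follows from the premises \<open>Js\<close> by \<open>r\<close>.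
  The channel introduced by a cut must be fresh for the conclusion, including its constraints,
  and for the further channels in \<open>N\<close>.
\<close>

inductive rule_inst ::
  "('l, 't) sig \<Rightarrow> chan set \<Rightarrow> ('t, 'x) rule_name \<Rightarrow> ('l, 't, 'x) jdg fset \<Rightarrow>
   ('l, 't, 'x) jdg \<Rightarrow> bool"
  for \<Sigma> N where
  ri_Id: "rule_inst \<Sigma> N RId {||} (Jdg (Some (x, A)) \<Omega> Fwd (y, A))"
| ri_Cut: "w \<notin> N \<Longrightarrow> w \<notin> jdg_chans (Jdg \<Gamma> \<Omega> (Cut P Q) (y, C)) \<Longrightarrow> tvars A \<subseteq> dom \<Sigma> \<Longrightarrow>
    rule_inst \<Sigma> N RCut
      {| Jdg \<Gamma> (\<Omega> \<union> cut_link \<Sigma> A (w, 0) (Some y)) P ((w, 0), A),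
         Jdg (Some ((w, 0), A)) (\<Omega> \<union> cut_link \<Sigma> A (w, 0) (map_option fst \<Gamma>)) Q (y, C) |}
      (Jdg \<Gamma> \<Omega> (Cut P Q) (y, C))"
| ri_PlusR: "fmlookup As k = Some A \<Longrightarrow>
    rule_inst \<Sigma> N RPlusR {| Jdg \<Gamma> \<Omega> P (y, A) |} (Jdg \<Gamma> \<Omega> (SendR k P) (y, Plus As))"
| ri_PlusL: "fmdom Qs = fmdom As \<Longrightarrow>
    rule_inst \<Sigma> N RPlusL
      ((\<lambda>l. Jdg (Some (x, the (fmlookup As l))) \<Omega> (the (fmlookup Qs l)) \<Delta>) |`| fmdom As)
      (Jdg (Some (x, Plus As)) \<Omega> (CaseL Qs) \<Delta>)"
| ri_WithR: "fmdom Ps = fmdom As \<Longrightarrow>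
    rule_inst \<Sigma> N RWithR
      ((\<lambda>l. Jdg \<Gamma> \<Omega> (the (fmlookup Ps l)) (y, the (fmlookup As l))) |`| fmdom As)
      (Jdg \<Gamma> \<Omega> (CaseR Ps) (y, With As))"
| ri_WithL: "fmlookup As k = Some A \<Longrightarrow>
    rule_inst \<Sigma> N RWithL {| Jdg (Some (x, A)) \<Omega> P \<Delta> |} (Jdg (Some (x, With As)) \<Omega> (SendL k P) \<Delta>)"
| ri_OneR: "rule_inst \<Sigma> N ROneR {||} (Jdg None \<Omega> CloseR (y, One))"
| ri_OneL: "rule_inst \<Sigma> N ROneL {| Jdg None \<Omega> Q \<Delta> |} (Jdg (Some (x, One)) \<Omega> (WaitL Q) \<Delta>)"
| ri_MuR: "\<Sigma> t = Some (i, Mu, A) \<Longrightarrow>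
    rule_inst \<Sigma> N (RMuR t)
      {| Jdg \<Gamma> (\<Omega> \<union> eq_other \<Sigma> i (y, Suc \<beta>) (y, \<beta>)) P ((y, Suc \<beta>), A) |}
      (Jdg \<Gamma> \<Omega> (SendRMu t P) ((y, \<beta>), TVar t))"
| ri_MuL: "\<Sigma> t = Some (i, Mu, A) \<Longrightarrow>
    rule_inst \<Sigma> N (RMuL t)
      {| Jdg (Some ((x, Suc \<alpha>), A))
           (\<Omega> \<union> {Less i (x, Suc \<alpha>) (x, \<alpha>)} \<union> eq_other \<Sigma> i (x, Suc \<alpha>) (x, \<alpha>)) Q \<Delta> |}
      (Jdg (Some ((x, \<alpha>), TVar t)) \<Omega> (CaseLMu t Q) \<Delta>)"
| ri_NuR: "\<Sigma> t = Some (i, Nu, A) \<Longrightarrow>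
    rule_inst \<Sigma> N (RNuR t)
      {| Jdg \<Gamma> (\<Omega> \<union> {Less i (y, Suc \<beta>) (y, \<beta>)} \<union> eq_other \<Sigma> i (y, Suc \<beta>) (y, \<beta>)) P
           ((y, Suc \<beta>), A) |}
      (Jdg \<Gamma> \<Omega> (CaseRNu t P) ((y, \<beta>), TVar t))"
| ri_NuL: "\<Sigma> t = Some (i, Nu, A) \<Longrightarrow>
    rule_inst \<Sigma> N (RNuL t)
      {| Jdg (Some ((x, Suc \<alpha>), A)) (\<Omega> \<union> eq_other \<Sigma> i (x, Suc \<alpha>) (x, \<alpha>)) Q \<Delta> |}
      (Jdg (Some ((x, \<alpha>), TVar t)) \<Omega> (SendLNu t Q) \<Delta>)"

definition call_of :: "('l, 't, 'x) pdef \<Rightarrow> ('l, 't, 'x) jdg \<Rightarrow> bool" where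
  "call_of d J \<longleftrightarrow> jproc J = Call (pname d) \<and>
     map_option snd (jleft J) = map_option snd (pleft d) \<and> snd (jright J) = snd (pright d)"

codatatype ('l, 't, 'x) deriv =
  Deriv (drule: "('t, 'x) rule_name") (dconcl: "('l, 't, 'x) jdg")
        (dprems: "('l, 't, 'x) deriv fset")

text \<open>The set \<open>N\<close> collects the channels occurring in the judgments below the current one, so
  that the channel introduced by a cut is fresh for the whole branch.\<close>

coinductive is_deriv ::
  "('l, 't) sig \<Rightarrow> ('l, 't, 'x) pdef set \<Rightarrow> chan set \<Rightarrow> ('l, 't, 'x) deriv \<Rightarrow> bool"
  for \<Sigma> V where
  id_rule: "rule_inst \<Sigma> N r (dconcl |`| Ds) J \<Longrightarrow>
    \<forall>D. D |\<in>| Ds \<longrightarrow> is_deriv \<Sigma> V (N \<union> jdg_chans J) D \<Longrightarrow>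
    is_deriv \<Sigma> V N (Deriv r J Ds)"
| id_Def: "d \<in> V \<Longrightarrow> call_of d J \<Longrightarrow> dconcl D = Jdg (jleft J) (jrels J) (pbody d) (jright J) \<Longrightarrow>
    is_deriv \<Sigma> V (N \<union> jdg_chans J) D \<Longrightarrow>
    is_deriv \<Sigma> V N (Deriv (RDef (pname d)) J {|D|})"

text \<open>\<open>path D rs D'\<close>: going up from the root of \<open>D\<close> to the root of its subderivation \<open>D'\<close>, the
  rules \<open>rs\<close> are applied.\<close>

inductive path ::
  "('l, 't, 'x) deriv \<Rightarrow> ('t, 'x) rule_name list \<Rightarrow> ('l, 't, 'x) deriv \<Rightarrow> bool" where
  "path D [] D"
| "D' |\<in>| dprems D \<Longrightarrow> path D' rs D'' \<Longrightarrow> path D (drule D # rs) D''"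

text \<open>A subtree of an infinitary derivation is again an infinitary derivation, so it suffices to
  consider cycles that start at the root.\<close>

definition is_cycle ::
  "('l, 't) sig \<Rightarrow> ('l, 't, 'x) program \<Rightarrow> ('l, 't, 'x) deriv \<Rightarrow> ('t, 'x) rule_name list \<Rightarrow>
   ('l, 't, 'x) deriv \<Rightarrow> bool" where
  "is_cycle \<Sigma> \<P> D rs D' \<longleftrightarrow> is_deriv \<Sigma> (fst \<P>) {} D \<and> path D rs D' \<and> rs \<noteq> [] \<and>
     (\<exists>X. jproc (dconcl D) = Call X \<and> jproc (dconcl D') = Call X)"

definition left_traceable :: "('l, 't, 'x) jdg \<Rightarrow> ('l, 't, 'x) jdg \<Rightarrow> bool" where
  "left_traceable J J' \<longleftrightarrow>
     (\<exists>z \<alpha> A \<gamma> A'. jleft J = Some ((z, \<alpha>), A) \<and> jleft J' = Some ((z, \<gamma>), A'))"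

definition right_traceable :: "('l, 't, 'x) jdg \<Rightarrow> ('l, 't, 'x) jdg \<Rightarrow> bool" where
  "right_traceable J J' \<longleftrightarrow> fst (fst (jright J)) = fst (fst (jright J'))"

definition left_prios :: "('l, 't) sig \<Rightarrow> ('t, 'x) rule_name list \<Rightarrow> nat set" where
  "left_prios \<Sigma> rs = {prio \<Sigma> t | t. RMuL t \<in> set rs \<or> RNuL t \<in> set rs}"

definition right_prios :: "('l, 't) sig \<Rightarrow> ('t, 'x) rule_name list \<Rightarrow> nat set" where
  "right_prios \<Sigma> rs = {prio \<Sigma> t | t. RMuR t \<in> set rs \<or> RNuR t \<in> set rs}"

definition left_mu_trace ::
  "('l, 't) sig \<Rightarrow> ('l, 't, 'x) deriv \<Rightarrow> ('t, 'x) rule_name list \<Rightarrow> ('l, 't, 'x) deriv \<Rightarrow> bool" where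
  "left_mu_trace \<Sigma> D rs D' \<longleftrightarrow> left_traceable (dconcl D) (dconcl D') \<and>
     left_prios \<Sigma> rs \<noteq> {} \<and> has_polarity \<Sigma> (Min (left_prios \<Sigma> rs)) Mu"

definition right_nu_trace ::
  "('l, 't) sig \<Rightarrow> ('l, 't, 'x) deriv \<Rightarrow> ('t, 'x) rule_name list \<Rightarrow> ('l, 't, 'x) deriv \<Rightarrow> bool" where
  "right_nu_trace \<Sigma> D rs D' \<longleftrightarrow> right_traceable (dconcl D) (dconcl D') \<and>
     right_prios \<Sigma> rs \<noteq> {} \<and> has_polarity \<Sigma> (Min (right_prios \<Sigma> rs)) Nu"

definition fs_guard :: "('l, 't) sig \<Rightarrow> ('l, 't, 'x) program \<Rightarrow> bool" where
  "fs_guard \<Sigma> \<P> \<longleftrightarrow>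
     (\<forall>D rs D'. is_cycle \<Sigma> \<P> D rs D' \<longrightarrow> left_mu_trace \<Sigma> D rs D' \<or> right_nu_trace \<Sigma> D rs D')"

text \<open>The domains of the partial orders \<open>ord 0, \<dots>, ord n\<close> are their fields.\<close>

definition order_family ::
  "('l, 't) sig \<Rightarrow> ('l, 't, 'x) program \<Rightarrow> (nat \<Rightarrow> 'x rel) \<Rightarrow> bool" where
  "order_family \<Sigma> \<P> ord \<longleftrightarrow>
     (\<forall>i\<le>lowest \<Sigma>. partial_order_on (Field (ord i)) (ord i)) \<and>
     (\<forall>i\<le>lowest \<Sigma>. \<forall>j\<le>lowest \<Sigma>. i \<noteq> j \<longrightarrow> Field (ord i) \<inter> Field (ord j) = {}) \<and>
     (\<Union>i\<le>lowest \<Sigma>. Field (ord i)) = pname ` fst \<P>"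

text \<open>An entry of \<open>list(x, y)\<close> is a pair of channels, either of which may be the empty left
  channel.  The empty channel is comparable only to itself.\<close>

type_synonym entry = "gchan option \<times> gchan option"

definition chan_list :: "('l, 't) sig \<Rightarrow> gchan option \<Rightarrow> gchan \<Rightarrow> entry list" where
  "chan_list \<Sigma> x y =
     map (\<lambda>i. if has_polarity \<Sigma> i Mu then (x, Some y) else (Some y, x)) [1..<Suc (lowest \<Sigma>)]"

definition entry_eq :: "constr set \<Rightarrow> nat \<Rightarrow> entry \<Rightarrow> entry \<Rightarrow> bool" where
  "entry_eq \<Omega> i e f \<longleftrightarrow>
     rel_option (ch_eq \<Omega> i) (fst e) (fst f) \<and> rel_option (ch_eq \<Omega> i) (snd e) (snd f)"

definition opt_less :: "constr set \<Rightarrow> nat \<Rightarrow> gchan option \<Rightarrow> gchan option \<Rightarrow> bool" where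
  "opt_less \<Omega> i u v \<longleftrightarrow> (\<exists>a b. u = Some a \<and> v = Some b \<and> ch_less \<Omega> i a b)"

definition entry_less :: "constr set \<Rightarrow> nat \<Rightarrow> entry \<Rightarrow> entry \<Rightarrow> bool" where
  "entry_less \<Omega> i e f \<longleftrightarrow>
     opt_less \<Omega> i (fst e) (fst f) \<or>
     rel_option (ch_eq \<Omega> i) (fst e) (fst f) \<and> opt_less \<Omega> i (snd e) (snd f)"

text \<open>The list position \<open>k\<close> holds the entry for priority \<open>Suc k\<close>; both relations compare the
  entries for the priorities \<open>1, \<dots>, m\<close> only.\<close>

definition prefix_eq :: "constr set \<Rightarrow> nat \<Rightarrow> entry list \<Rightarrow> entry list \<Rightarrow> bool" where
  "prefix_eq \<Omega> m es fs \<longleftrightarrow> (\<forall>k<m. entry_eq \<Omega> (Suc k) (es ! k) (fs ! k))"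

definition prefix_less :: "constr set \<Rightarrow> nat \<Rightarrow> entry list \<Rightarrow> entry list \<Rightarrow> bool" where
  "prefix_less \<Omega> m es fs \<longleftrightarrow>
     (\<exists>k<m. prefix_eq \<Omega> k es fs \<and> entry_less \<Omega> (Suc k) (es ! k) (fs ! k))"

text \<open>
  The order \<open>(\<subset>, <)\<close>: a process variable in the domain of \<open>ord i\<close> is inserted into the
  list after the entry for priority \<open>i\<close>, and the extended lists are compared lexicographically.
  For related variables in the domain of \<open>ord i\<close> the first \<open>i\<close> entries decide, up to equality;
  for the same variable the whole list is compared; in all remaining cases the strict decrease
  has to occur before either of the variables is reached.
\<close>

definition call_less ::
  "('l, 't) sig \<Rightarrow> (nat \<Rightarrow> 'x rel) \<Rightarrow> constr set \<Rightarrow> 'x \<times> entry list \<Rightarrow> 'x \<times> entry list \<Rightarrow> bool" where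
  "call_less \<Sigma> ord \<Omega> p q \<longleftrightarrow> (case (p, q) of ((Y, es), (X, fs)) \<Rightarrow>
     (\<exists>i\<le>lowest \<Sigma>. (Y, X) \<in> ord i \<and> Y \<noteq> X \<and> (prefix_less \<Omega> i es fs \<or> prefix_eq \<Omega> i es fs)) \<or>
     (Y = X \<and> prefix_less \<Omega> (lowest \<Sigma>) es fs) \<or>
     (\<exists>i\<le>lowest \<Sigma>. \<exists>j\<le>lowest \<Sigma>. Y \<in> Field (ord i) \<and> X \<in> Field (ord j) \<and>
        prefix_less \<Omega> (min i j) es fs))"

text \<open>
  The finitary system, for a check that started from the process variable \<open>X\<close> with left
  channel \<open>u\<close> and right channel \<open>v\<close>.
\<close>

inductive checks ::
  "('l, 't) sig \<Rightarrow> ('l, 't, 'x) pdef set \<Rightarrow> (nat \<Rightarrow> 'x rel) \<Rightarrow>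
   gchan option \<Rightarrow> 'x \<Rightarrow> gchan \<Rightarrow> ('l, 't, 'x) jdg \<Rightarrow> bool"
  for \<Sigma> V ord u X v where
  ch_rule: "rule_inst \<Sigma> (fst ` (set_option u \<union> {v})) r Js J \<Longrightarrow>
    \<forall>J'. J' |\<in>| Js \<longrightarrow> checks \<Sigma> V ord u X v J' \<Longrightarrow> checks \<Sigma> V ord u X v J"
| ch_Call: "d \<in> V \<Longrightarrow> call_of d J \<Longrightarrow>
    call_less \<Sigma> ord (jrels J)
      (pname d, chan_list \<Sigma> (map_option fst (jleft J)) (fst (jright J))) (X, chan_list \<Sigma> u v) \<Longrightarrow>
    checks \<Sigma> V ord u X v J"

definition locally_valid ::
  "('l, 't) sig \<Rightarrow> (nat \<Rightarrow> 'x rel) \<Rightarrow> ('l, 't, 'x) program \<Rightarrow> bool" where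
  "locally_valid \<Sigma> ord \<P> \<longleftrightarrow>
     (\<forall>d \<in> fst \<P>.
        let z = map_option (\<lambda>(x, A). ((x, 0), A)) (pleft d);
            w = ((fst (pright d), 0), snd (pright d))
        in checks \<Sigma> (fst \<P>) ord (map_option fst z) (pname d) (fst w) (Jdg z {} (pbody d) w))"

end

theory Submission
  imports Defs
begin

text \<open>
  A cycle of an infinitary derivation is a concatenation of stretches from one process call to the
  next. The finitary check of the definition unfolded at the start of such a stretch applies the same
  rules to the same process terms, though possibly at other cut and choice types, so it certifies
  that the call at the end of the stretch is smaller than the one at its start. The constraints
  collected by different checks live on unrelated channels and cannot be joined directly. What is
  composed instead is what an equality \<open>x\<^sub>i = u\<^sub>i\<close> or a decrease \<open>x\<^sub>i < u\<^sub>i\<close> derivable from them reveals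
  about the stretch itself: whether \<open>u\<close> was replaced by a cut, which priorities were unfolded, and
  whether the types depend on \<open>i\<close>. In this form \<open>(\<subset>, <)\<close> is transitive. On a whole cycle the process
  variable and hence the types are the same at both ends; then the decrease has to happen at
  some priority on a channel that persists along the cycle, by a least fixed point rule on the left or
  a greatest fixed point rule on the right, with no rule of a higher priority on that side.
\<close>

section \<open>Dependence of types on priorities\<close>

lemma dep_unfold:
  "\<Sigma> t = Some (p, a, B) \<Longrightarrow> dep \<Sigma> (TVar t) i \<longleftrightarrow> i = p \<or> dep \<Sigma> B i"
  by (auto intro: dep.intros elim: dep.cases)

section \<open>Models of constraint sets\<close>

text \<open>The order is reversed: a smaller channel has made more decreases and has the larger
  rank. \<open>None\<close> compares only with \<open>None\<close>, so no strict constraint links a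
  related channel to an unrelated one.\<close>

definition rank_less :: "nat option \<Rightarrow> nat option \<Rightarrow> bool" where
  "rank_less p q \<longleftrightarrow> (case q of None \<Rightarrow> p = None | Some s \<Rightarrow> \<exists>r>s. p = Some r)"

text \<open>A valuation assigns to a channel the number of strict decreases that separate it from the
  channel a check started from, and \<open>None\<close> if it is unrelated to that channel.\<close>

definition models :: "nat \<Rightarrow> (gchan \<Rightarrow> nat option) \<Rightarrow> constr set \<Rightarrow> bool" where
  "models i \<phi> \<Omega> \<longleftrightarrow>
     (\<forall>a b. Equal i a b \<in> \<Omega> \<longrightarrow> \<phi> a = \<phi> b) \<and> (\<forall>a b. Less i a b \<in> \<Omega> \<longrightarrow> rank_less (\<phi> a) (\<phi> b))"

text \<open>Soundness: what is derivable from a constraint set holds in each of its models, so one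
  suitable model controls everything that a check can derive at priority \<open>i\<close>.\<close>

lemma models_ch_eq:
  assumes "models i \<phi> \<Omega>" "ch_eq \<Omega> i a b" shows "\<phi> a = \<phi> b"
  using assms(2) unfolding ch_eq_def
  by (induction rule: equivclp_induct) (use assms(1) in \<open>auto simp: models_def\<close>)

lemma models_ch_less:
  assumes "models i \<phi> \<Omega>" "ch_less \<Omega> i a b" shows "rank_less (\<phi> a) (\<phi> b)"
  using assms(2)
proof induction
  case (1 a a' b' b)
  then show ?case
    using assms(1) models_ch_eq[OF assms(1)] by (metis models_def)
next
  case (2 a b c)
  then show ?case by (force simp: rank_less_def split: option.splits)
qed

fun constr_gchans :: "constr \<Rightarrow> gchan set" where
  "constr_gchans (Less i a b) = {a, b}"
| "constr_gchans (Equal i a b) = {a, b}"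

lemma constr_chans_eq: "constr_chans c = fst ` constr_gchans c"
  by (cases c) auto

lemma models_Un: "models i \<phi> (\<Omega> \<union> \<Omega>') \<longleftrightarrow> models i \<phi> \<Omega> \<and> models i \<phi> \<Omega>'"
  by (auto simp: models_def)

lemma models_cut_link:
  "(\<And>b. v = Some b \<Longrightarrow> \<not> dep \<Sigma> A i \<Longrightarrow> \<phi> a = \<phi> b) \<Longrightarrow> models i \<phi> (cut_link \<Sigma> A a v)"
  by (auto simp: models_def cut_link_def)

section \<open>Comparing the two ends of a path on one side\<close>

text \<open>The arguments \<open>A\<close> and \<open>B\<close> are the types at the start and at the end of the path, \<open>k\<close> tells
  whether the channel has never been replaced by a cut and \<open>ps\<close> is the set of priorities of the
  fixed point rules applied to this side. A channel \<open>w\<close> introduced by a cut inherits the level of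
  the channel it replaces only at priorities on which its type does not depend; hence no such
  priority can ever decrease on \<open>w\<close>.\<close>

definition level_eq ::
  "('l, 't) sig \<Rightarrow> nat \<Rightarrow> ('l, 't) tp \<Rightarrow> ('l, 't) tp \<Rightarrow> bool \<Rightarrow> nat set \<Rightarrow> bool" where
  "level_eq \<Sigma> i A B k ps \<longleftrightarrow>
     (if k then i \<notin> ps \<and> (dep \<Sigma> B i \<longrightarrow> dep \<Sigma> A i) else \<not> dep \<Sigma> B i)"

text \<open>Demanding \<open>dep \<Sigma> A i\<close> makes the case of a replaced channel
  contradictory when both ends have the same type, as on a cycle.\<close>

definition level_less ::
  "('l, 't) sig \<Rightarrow> polarity \<Rightarrow> nat \<Rightarrow> ('l, 't) tp \<Rightarrow> ('l, 't) tp \<Rightarrow> bool \<Rightarrow> nat set \<Rightarrow> bool" where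
  "level_less \<Sigma> a i A B k ps \<longleftrightarrow>
     has_polarity \<Sigma> i a \<and> dep \<Sigma> A i \<and> (if k then i \<in> ps else \<not> dep \<Sigma> B i)"

definition side_eq ::
  "('l, 't) sig \<Rightarrow> nat \<Rightarrow> ('l, 't) tp option \<Rightarrow> ('l, 't) tp option \<Rightarrow> bool \<Rightarrow> nat set \<Rightarrow> bool" where
  "side_eq \<Sigma> i S T k ps \<longleftrightarrow> rel_option (\<lambda>A B. level_eq \<Sigma> i A B k ps) S T"

definition side_less ::
  "('l, 't) sig \<Rightarrow> polarity \<Rightarrow> nat \<Rightarrow> ('l, 't) tp option \<Rightarrow> ('l, 't) tp option \<Rightarrow> bool \<Rightarrow> nat set \<Rightarrow>
   bool" where
  "side_less \<Sigma> a i S T k ps \<longleftrightarrow> (\<exists>A B. S = Some A \<and> T = Some B \<and> level_less \<Sigma> a i A B k ps)"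

text \<open>Stretches compose because an equality never adds a dependence on \<open>i\<close>,
  whatever \<open>k\<close> is; once a replacement has removed the dependence, it stays
  removed.\<close>

lemma side_eq_trans:
  "side_eq \<Sigma> i S T k ps \<Longrightarrow> side_eq \<Sigma> i T U k' ps' \<Longrightarrow> side_eq \<Sigma> i S U (k \<and> k') (ps \<union> ps')"
  by (cases S; cases T; cases U) (auto simp: side_eq_def level_eq_def split: if_splits)

lemma side_eq_less_trans:
  "side_eq \<Sigma> i S T k ps \<Longrightarrow> side_less \<Sigma> a i T U k' ps' \<Longrightarrow>
   side_less \<Sigma> a i S U (k \<and> k') (ps \<union> ps')"
  by (cases S; cases T; cases U)
    (auto simp: side_eq_def side_less_def level_eq_def level_less_def split: if_splits)

lemma side_less_eq_trans:
  "side_less \<Sigma> a i S T k ps \<Longrightarrow> side_eq \<Sigma> i T U k' ps' \<Longrightarrow>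
   side_less \<Sigma> a i S U (k \<and> k') (ps \<union> ps')"
  by (cases S; cases T; cases U)
    (auto simp: side_eq_def side_less_def level_eq_def level_less_def split: if_splits)

lemma side_less_trans:
  "side_less \<Sigma> a i S T k ps \<Longrightarrow> side_less \<Sigma> a i T U k' ps' \<Longrightarrow>
   side_less \<Sigma> a i S U (k \<and> k') (ps \<union> ps')"
  by (cases S; cases T; cases U)
    (auto simp: side_eq_def side_less_def level_eq_def level_less_def split: if_splits)

text \<open>Translates the rank of the current channel into a statement on the stretch. Rank
  \<open>None\<close> claims nothing: such a channel is not derivably comparable with a start
  channel, whose rank is \<open>Some 0\<close>.\<close>

definition side_inv ::
  "('l, 't) sig \<Rightarrow> polarity \<Rightarrow> nat \<Rightarrow> ('l, 't) tp option \<Rightarrow> bool \<Rightarrow> nat set \<Rightarrow>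
   (gchan \<Rightarrow> nat option) \<Rightarrow> (gchan \<times> ('l, 't) tp) option \<Rightarrow> bool" where
  "side_inv \<Sigma> a i S k ps \<phi> c \<longleftrightarrow> (\<forall>x B r. c = Some (x, B) \<longrightarrow> \<phi> x = Some r \<longrightarrow>
     (if r = 0 then side_eq \<Sigma> i S (Some B) k ps else side_less \<Sigma> a i S (Some B) k ps))"

lemma side_inv_None [simp]: "side_inv \<Sigma> a i S k ps \<phi> None"
  by (simp add: side_inv_def)

lemma side_inv_Some:
  "side_inv \<Sigma> a i S k ps \<phi> (Some (x, B)) \<longleftrightarrow> (\<forall>r. \<phi> x = Some r \<longrightarrow>
     (if r = 0 then side_eq \<Sigma> i S (Some B) k ps else side_less \<Sigma> a i S (Some B) k ps))"
  by (simp add: side_inv_def)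

text \<open>\<open>TVar t\<close> depends on \<open>p\<close>, so at \<open>i = p\<close> a ranked
  channel cannot have been replaced, and unfolding yields a decrease if the rule records one
  (\<open>b = a\<close>). Otherwise nothing is recorded at \<open>p\<close> and the new generation
  is unrelated. At other priorities the dependence does not change.\<close>

lemma side_inv_unfold:
  assumes "\<Sigma> t = Some (p, b, B)" "side_inv \<Sigma> a i S k ps \<phi> (Some (x, TVar t))"
    and "\<phi>' y = (if i \<noteq> p then \<phi> x else if b = a then map_option Suc (\<phi> x) else None)"
  shows "side_inv \<Sigma> a i S k (insert p ps) \<phi>' (Some (y, B))"
  using assms(2,3) dep_unfold[of \<Sigma> t p b B i] assms(1)
  by (cases S; cases "\<phi> x")
    (auto simp: side_inv_Some side_eq_def side_less_def level_eq_def level_less_def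
      has_polarity_def split: if_splits)

lemma side_inv_mono:
  assumes "side_inv \<Sigma> a i S k ps \<phi> (Some (x, B))" "\<And>i. dep \<Sigma> B' i \<Longrightarrow> dep \<Sigma> B i"
  shows "side_inv \<Sigma> a i S k ps \<phi> (Some (x, B'))"
  using assms by (cases S; cases "\<phi> x")
    (auto simp: side_inv_Some side_eq_def side_less_def level_eq_def level_less_def split: if_splits)

text \<open>The new channel is ranked only where \<open>B\<close> does not depend on
  \<open>i\<close>, which is what both levels ask of the end type after a replacement; polarity and
  dependence of the start type are inherited from \<open>c\<close>.\<close>

lemma side_inv_cut:
  assumes "side_inv \<Sigma> a i S k ps \<phi> c"
    and "\<phi>' y = (if dep \<Sigma> B i then None else Option.bind c (\<lambda>z. \<phi> (fst z)))"
  shows "side_inv \<Sigma> a i S False ps \<phi>' (Some (y, B))"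
proof (cases c)
  case (Some z)
  then show ?thesis
    using assms by (cases z; cases S; cases "\<phi> (fst z)")
      (auto simp: side_inv_Some side_eq_def side_less_def level_eq_def level_less_def split: if_splits)
qed (use assms in \<open>simp add: side_inv_Some split: if_splits\<close>)

lemma side_inv_upd_other:
  "side_inv \<Sigma> a i S k ps \<phi> c \<Longrightarrow> (\<And>x. c = Some x \<Longrightarrow> fst x \<noteq> n) \<Longrightarrow>
   side_inv \<Sigma> a i S k ps (\<phi>(n := r)) c"
  unfolding side_inv_def by fastforce

section \<open>The invariant of a check\<close>

text \<open>Names only, as generations grow by unfolding. Two empty sides count as kept; the
  nonemptiness that \<open>left_traceable\<close> demands is recovered at the end from the type of
  the left channel.\<close>

definition left_kept :: "('l, 't, 'x) jdg \<Rightarrow> ('l, 't, 'x) jdg \<Rightarrow> bool" where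
  "left_kept J J' \<longleftrightarrow> map_option (fst \<circ> fst) (jleft J) = map_option (fst \<circ> fst) (jleft J')"

definition right_kept :: "('l, 't, 'x) jdg \<Rightarrow> ('l, 't, 'x) jdg \<Rightarrow> bool" where
  "right_kept J J' \<longleftrightarrow> fst (fst (jright J)) = fst (fst (jright J'))"

section \<open>Freshness of channel generations\<close>

definition gchans :: "constr set \<Rightarrow> gchan set" where
  "gchans \<Omega> = \<Union> (constr_gchans ` \<Omega>)"

lemma gchans_empty [simp]: "gchans {} = {}"
  by (simp add: gchans_def)

lemma gchans_Un [simp]: "gchans (\<Omega> \<union> \<Omega>') = gchans \<Omega> \<union> gchans \<Omega>'"
  by (simp add: gchans_def)

lemma gchans_Less [simp]: "gchans {Less p a b} = {a, b}"
  by (simp add: gchans_def)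

lemma gchans_eq_other: "gchans (eq_other \<Sigma> p a b) \<subseteq> {a, b}"
  by (auto simp: gchans_def eq_other_def)

lemma gchans_cut_link: "gchans (cut_link \<Sigma> A n v) \<subseteq> insert n (set_option v)"
  by (auto simp: gchans_def cut_link_def)

lemma models_fun_upd:
  assumes "models i \<phi> \<Omega>" "n \<notin> gchans \<Omega>"
  shows "models i (\<phi>(n := r)) \<Omega>"
  using assms unfolding models_def gchans_def by fastforce

lemma gchans_fresh: "w \<notin> jdg_chans J \<Longrightarrow> (w, g) \<notin> gchans (jrels J)"
  unfolding jdg_chans_def gchans_def by (fastforce simp: constr_chans_eq image_iff)

text \<open>The cut rule asks for a fresh name, but an unfolding reuses an old one. That its next
  generation is new has to be carried along as an invariant, so that the valuation may be redefined
  there.\<close>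

definition newest :: "gchan set \<Rightarrow> gchan \<Rightarrow> bool" where
  "newest U c \<longleftrightarrow> (\<forall>g > snd c. (fst c, g) \<notin> U)"

lemma newest_mono: "newest U c \<Longrightarrow> V \<subseteq> U \<union> W \<Longrightarrow> newest W c \<Longrightarrow> newest V c"
  by (auto simp: newest_def)

lemma newest_Suc: "newest U (x, \<alpha>) \<Longrightarrow> newest U (x, Suc \<alpha>)"
  by (simp add: newest_def)

lemma newest_Suc_notin: "newest U (x, \<alpha>) \<Longrightarrow> (x, Suc \<alpha>) \<notin> U"
  by (simp add: newest_def)

lemma newest_other: "(\<And>d. d \<in> U \<Longrightarrow> fst d = fst c \<Longrightarrow> snd d \<le> snd c) \<Longrightarrow> newest U c"
  by (fastforce simp: newest_def)

definition check_model ::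
  "('l, 't) sig \<Rightarrow> (gchan \<times> ('l, 't) tp) option \<Rightarrow> gchan \<times> ('l, 't) tp \<Rightarrow> bool \<Rightarrow> bool \<Rightarrow>
   nat set \<Rightarrow> nat set \<Rightarrow> (gchan \<times> ('l, 't) tp) option \<Rightarrow> constr set \<Rightarrow> gchan \<times> ('l, 't) tp \<Rightarrow>
   nat \<Rightarrow> (gchan \<Rightarrow> nat option) \<Rightarrow> bool" where
  "check_model \<Sigma> l r kl kr pl pr L \<Omega> R i \<phi> \<longleftrightarrow>
     models i \<phi> \<Omega> \<and> (\<forall>c \<in> fst ` (set_option l \<union> {r}). \<phi> c = Some 0) \<and>
     side_inv \<Sigma> Mu i (map_option snd l) kl pl \<phi> L \<and>
     side_inv \<Sigma> Nu i (Some (snd r)) kr pr \<phi> (Some R)"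

text \<open>Each priority has its own valuation, while the flags and priority sets are common to all
  of them. As the two current channels have distinct names, the valuation can be extended on one
  side without touching the other.\<close>

definition check_inv ::
  "('l, 't) sig \<Rightarrow> (gchan \<times> ('l, 't) tp) option \<Rightarrow> gchan \<times> ('l, 't) tp \<Rightarrow> bool \<Rightarrow> bool \<Rightarrow>
   nat set \<Rightarrow> nat set \<Rightarrow> (gchan \<times> ('l, 't) tp) option \<Rightarrow> constr set \<Rightarrow> gchan \<times> ('l, 't) tp \<Rightarrow>
   bool" where
  "check_inv \<Sigma> l r kl kr pl pr L \<Omega> R \<longleftrightarrow>
     (\<forall>c \<in> set_option L. fst (fst c) \<noteq> fst (fst R) \<and>
        newest (gchans \<Omega> \<union> fst ` (set_option l \<union> {r})) (fst c)) \<and>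
     newest (gchans \<Omega> \<union> fst ` (set_option l \<union> {r})) (fst R) \<and>
     (\<forall>i. \<exists>\<phi>. check_model \<Sigma> l r kl kr pl pr L \<Omega> R i \<phi>)"

section \<open>The invariant at the start and under single rules\<close>

lemma check_inv_start:
  assumes "\<And>c. l = Some c \<Longrightarrow> fst (fst c) \<noteq> fst (fst r)"
    and "\<And>c. l = Some c \<Longrightarrow> snd (fst c) = 0" and "snd (fst r) = 0"
  shows "check_inv \<Sigma> l r True True {} {} l {} r"
proof -
  have "check_model \<Sigma> l r True True {} {} l {} r i (\<lambda>_. Some 0)" for i
    by (auto simp: check_model_def models_def side_inv_def side_eq_def level_eq_def)
  moreover have "newest (gchans {} \<union> fst ` (set_option l \<union> {r})) (fst c)" if "c \<in> set_option l \<union> {r}" for c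
    by (rule newest_other) (use that assms in auto)
  ultimately show ?thesis
    using assms(1) unfolding check_inv_def by (metis Un_iff elem_set singletonI)
qed

text \<open>Covers the rules that add no constraints: choices pass to a component type with no
  further dependences, and the left rule for \<open>One\<close> drops the channel, after which
  \<open>kl'\<close> is arbitrary because nothing is claimed about an absent channel.\<close>

lemma check_inv_same:
  assumes inv: "check_inv \<Sigma> l r kl kr pl pr L \<Omega> R"
    and L': "L' = None \<or> kl' = kl \<and> (L' = L \<or> (\<exists>x A B. L = Some (x, A) \<and> L' = Some (x, B) \<and> (\<forall>i. dep \<Sigma> B i \<longrightarrow> dep \<Sigma> A i)))"
    and R': "R' = R \<or> (\<exists>x A B. R = (x, A) \<and> R' = (x, B) \<and> (\<forall>i. dep \<Sigma> B i \<longrightarrow> dep \<Sigma> A i))"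
  shows "check_inv \<Sigma> l r kl' kr pl pr L' \<Omega> R'"
proof -
  have "side_inv \<Sigma> Mu i S kl' pl \<phi> L'" if "side_inv \<Sigma> Mu i S kl pl \<phi> L" for i S \<phi>
    using that L' by (auto intro: side_inv_mono)
  moreover have "side_inv \<Sigma> Nu i S kr pr \<phi> (Some R')" if "side_inv \<Sigma> Nu i S kr pr \<phi> (Some R)" for i S \<phi>
    using that R' by (auto intro: side_inv_mono)
  ultimately have "check_model \<Sigma> l r kl' kr pl pr L' \<Omega> R' i \<phi>"
    if "check_model \<Sigma> l r kl kr pl pr L \<Omega> R i \<phi>" for i \<phi>
    using that unfolding check_model_def by blast
  moreover have "fst R' = fst R" using R' by auto
  moreover have "\<exists>c0 \<in> set_option L. fst c0 = fst c" if "c \<in> set_option L'" for c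
    using L' that by (elim disjE conjE exE) auto
  ultimately show ?thesis
    using inv unfolding check_inv_def by metis
qed

text \<open>Changing a valuation at an unseen generation \<open>n\<close> affects neither the old
  constraints nor the start channels, so only the new constraints and the two current channels
  remain to be checked.\<close>

lemma check_model_upd:
  assumes "check_model \<Sigma> l r kl kr pl pr L \<Omega> R i \<phi>" "n \<notin> gchans \<Omega> \<union> fst ` (set_option l \<union> {r})"
    and "models i (\<phi>(n := v)) \<Omega>'"
    and "side_inv \<Sigma> Mu i (map_option snd l) kl' pl' (\<phi>(n := v)) L'"
    and "side_inv \<Sigma> Nu i (Some (snd r)) kr' pr' (\<phi>(n := v)) (Some R')"
  shows "check_model \<Sigma> l r kl' kr' pl' pr' L' (\<Omega> \<union> \<Omega>') R' i (\<phi>(n := v))"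
proof -
  have "models i (\<phi>(n := v)) \<Omega>"
    by (rule models_fun_upd) (use assms(1,2) in \<open>auto simp: check_model_def\<close>)
  moreover have "\<forall>c \<in> fst ` (set_option l \<union> {r}). (\<phi>(n := v)) c = Some 0"
    using assms(1,2) unfolding check_model_def by (metis UnI2 fun_upd_other)
  ultimately show ?thesis
    using assms(3-5) unfolding check_model_def models_Un by blast
qed

text \<open>Common form of the constraints of the four fixed point rules: \<open>a\<close> is the
  polarity whose unfoldings are received on the given side (\<open>Mu\<close> left,
  \<open>Nu\<close> right), \<open>b\<close> that of the unfolded variable.\<close>

definition unfold_rels :: "('l, 't) sig \<Rightarrow> polarity \<Rightarrow> polarity \<Rightarrow> nat \<Rightarrow> chan \<Rightarrow> nat \<Rightarrow> constr set" where
  "unfold_rels \<Sigma> a b p x \<alpha> =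
     (if b = a then {Less p (x, Suc \<alpha>) (x, \<alpha>)} else {}) \<union> eq_other \<Sigma> p (x, Suc \<alpha>) (x, \<alpha>)"

lemma gchans_unfold_rels: "gchans (unfold_rels \<Sigma> a b p x \<alpha>) \<subseteq> {(x, Suc \<alpha>), (x, \<alpha>)}"
  using gchans_eq_other[of \<Sigma> p "(x, Suc \<alpha>)" "(x, \<alpha>)"] by (auto simp: unfold_rels_def)

lemma models_unfold_rels:
  assumes "\<phi> (x, Suc \<alpha>) =
    (if i \<noteq> p then \<phi> (x, \<alpha>) else if b = a then map_option Suc (\<phi> (x, \<alpha>)) else None)"
  shows "models i \<phi> (unfold_rels \<Sigma> a b p x \<alpha>)"
  using assms by (auto simp: unfold_rels_def models_def eq_other_def rank_less_def split: option.splits)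

lemma check_inv_left:
  assumes inv: "check_inv \<Sigma> l r kl kr pl pr (Some ((x, \<alpha>), TVar t)) \<Omega> R"
    and t: "\<Sigma> t = Some (p, a, B)"
  shows "check_inv \<Sigma> l r kl kr (insert p pl) pr
    (Some ((x, Suc \<alpha>), B)) (\<Omega> \<union> unfold_rels \<Sigma> Mu a p x \<alpha>) R"
proof -
  let ?U = "gchans \<Omega> \<union> fst ` (set_option l \<union> {r})"
  have xy: "x \<noteq> fst (fst R)" and x: "newest ?U (x, \<alpha>)" and R: "newest ?U (fst R)"
    using inv by (auto simp: check_inv_def)
  have U: "gchans (\<Omega> \<union> unfold_rels \<Sigma> Mu a p x \<alpha>) \<union> fst ` (set_option l \<union> {r})
      \<subseteq> ?U \<union> {(x, Suc \<alpha>), (x, \<alpha>)}"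
    using gchans_unfold_rels[of \<Sigma> Mu a p x \<alpha>] by auto
  have "\<exists>\<phi>. check_model \<Sigma> l r kl kr (insert p pl) pr (Some ((x, Suc \<alpha>), B))
          (\<Omega> \<union> unfold_rels \<Sigma> Mu a p x \<alpha>) R i \<phi>" for i
  proof -
    obtain \<phi> where \<phi>: "check_model \<Sigma> l r kl kr pl pr (Some ((x, \<alpha>), TVar t)) \<Omega> R i \<phi>"
      using inv unfolding check_inv_def by blast
    \<comment> \<open>Receiving (\<open>a = Mu\<close>) counts one more decrease at
      \<open>p\<close>; sending (\<open>a = Nu\<close>) records nothing at \<open>p\<close>, so the
      new generation becomes unrelated there.\<close>
    let ?v = "if i \<noteq> p then \<phi> (x, \<alpha>) else if a = Mu then map_option Suc (\<phi> (x, \<alpha>)) else None"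
    have "check_model \<Sigma> l r kl kr (insert p pl) pr (Some ((x, Suc \<alpha>), B))
        (\<Omega> \<union> unfold_rels \<Sigma> Mu a p x \<alpha>) R i (\<phi>((x, Suc \<alpha>) := ?v))"
    proof (rule check_model_upd[OF \<phi> newest_Suc_notin[OF x]])
      show "side_inv \<Sigma> Mu i (map_option snd l) kl (insert p pl) (\<phi>((x, Suc \<alpha>) := ?v)) (Some ((x, Suc \<alpha>), B))"
        by (rule side_inv_unfold[of \<Sigma> t p a B _ _ _ _ _ \<phi> "(x, \<alpha>)"])
          (use t \<phi> in \<open>simp_all add: check_model_def\<close>)
      show "side_inv \<Sigma> Nu i (Some (snd r)) kr pr (\<phi>((x, Suc \<alpha>) := ?v)) (Some R)"
        by (rule side_inv_upd_other) (use \<phi> xy in \<open>auto simp: check_model_def\<close>)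
    qed (rule models_unfold_rels, simp)
    then show ?thesis by blast
  qed
  moreover have "newest (gchans (\<Omega> \<union> unfold_rels \<Sigma> Mu a p x \<alpha>) \<union> fst ` (set_option l \<union> {r})) (x, Suc \<alpha>)"
    by (rule newest_mono[OF newest_Suc[OF x] U]) (auto simp: newest_def)
  moreover have "newest (gchans (\<Omega> \<union> unfold_rels \<Sigma> Mu a p x \<alpha>) \<union> fst ` (set_option l \<union> {r})) (fst R)"
    by (rule newest_mono[OF R U]) (use xy in \<open>auto simp: newest_def\<close>)
  ultimately show ?thesis
    using xy unfolding check_inv_def by simp
qed

lemma check_inv_right:
  assumes inv: "check_inv \<Sigma> l r kl kr pl pr L \<Omega> ((y, \<beta>), TVar t)"
    and t: "\<Sigma> t = Some (p, a, B)"
  shows "check_inv \<Sigma> l r kl kr pl (insert p pr)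
    L (\<Omega> \<union> unfold_rels \<Sigma> Nu a p y \<beta>) ((y, Suc \<beta>), B)"
proof -
  let ?U = "gchans \<Omega> \<union> fst ` (set_option l \<union> {r})"
  have y: "newest ?U (y, \<beta>)"
    and L: "\<And>c. c \<in> set_option L \<Longrightarrow> fst (fst c) \<noteq> y \<and> newest ?U (fst c)"
    using inv by (auto simp: check_inv_def)
  have U: "gchans (\<Omega> \<union> unfold_rels \<Sigma> Nu a p y \<beta>) \<union> fst ` (set_option l \<union> {r})
      \<subseteq> ?U \<union> {(y, Suc \<beta>), (y, \<beta>)}"
    using gchans_unfold_rels[of \<Sigma> Nu a p y \<beta>] by auto
  have "\<exists>\<phi>. check_model \<Sigma> l r kl kr pl (insert p pr) L
          (\<Omega> \<union> unfold_rels \<Sigma> Nu a p y \<beta>) ((y, Suc \<beta>), B) i \<phi>" for i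
  proof -
    obtain \<phi> where \<phi>: "check_model \<Sigma> l r kl kr pl pr L \<Omega> ((y, \<beta>), TVar t) i \<phi>"
      using inv unfolding check_inv_def by blast
    let ?v = "if i \<noteq> p then \<phi> (y, \<beta>) else if a = Nu then map_option Suc (\<phi> (y, \<beta>)) else None"
    have "check_model \<Sigma> l r kl kr pl (insert p pr) L
        (\<Omega> \<union> unfold_rels \<Sigma> Nu a p y \<beta>) ((y, Suc \<beta>), B) i (\<phi>((y, Suc \<beta>) := ?v))"
    proof (rule check_model_upd[OF \<phi> newest_Suc_notin[OF y]])
      show "side_inv \<Sigma> Nu i (Some (snd r)) kr (insert p pr) (\<phi>((y, Suc \<beta>) := ?v)) (Some ((y, Suc \<beta>), B))"
        by (rule side_inv_unfold[of \<Sigma> t p a B _ _ _ _ _ \<phi> "(y, \<beta>)"])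
          (use t \<phi> in \<open>simp_all add: check_model_def\<close>)
      show "side_inv \<Sigma> Mu i (map_option snd l) kl pl (\<phi>((y, Suc \<beta>) := ?v)) L"
        by (rule side_inv_upd_other) (use \<phi> L in \<open>fastforce simp: check_model_def\<close>)+
    qed (rule models_unfold_rels, simp)
    then show ?thesis by blast
  qed
  moreover have "newest (gchans (\<Omega> \<union> unfold_rels \<Sigma> Nu a p y \<beta>) \<union> fst ` (set_option l \<union> {r})) (y, Suc \<beta>)"
    by (rule newest_mono[OF newest_Suc[OF y] U]) (auto simp: newest_def)
  moreover have "newest (gchans (\<Omega> \<union> unfold_rels \<Sigma> Nu a p y \<beta>) \<union> fst ` (set_option l \<union> {r})) (fst c)"
    if "c \<in> set_option L" for c
    by (rule newest_mono[OF conjunct2[OF L[OF that]] U]) (use L[OF that] in \<open>auto simp: newest_def\<close>)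
  ultimately show ?thesis
    using L unfolding check_inv_def by simp
qed

text \<open>In the first premise of a cut \<open>w\<close> stands in for the right channel, which
  clears the right flag; being fresh also for the start channels, \<open>w\<close> can be ranked
  freely.\<close>

lemma check_inv_cut_right:
  assumes inv: "check_inv \<Sigma> l r kl kr pl pr L \<Omega> R"
    and w: "w \<notin> fst ` fst ` (set_option l \<union> {r})" "w \<notin> jdg_chans (Jdg L \<Omega> Q R)"
  shows "check_inv \<Sigma> l r kl False pl pr L (\<Omega> \<union> cut_link \<Sigma> A (w, 0) (Some (fst R))) ((w, 0), A)"
proof -
  let ?U = "gchans \<Omega> \<union> fst ` (set_option l \<union> {r})" and ?\<Omega> = "cut_link \<Sigma> A (w, 0) (Some (fst R))"
  have new: "(w, g) \<notin> ?U" for g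
    using w(1) gchans_fresh[OF w(2)] by (metis UnE fst_conv imageI jdg.sel(2))
  have R: "fst (fst R) \<noteq> w"
    using w(2) by (auto simp: jdg_chans_def)
  have L: "fst (fst c) \<noteq> w \<and> fst (fst c) \<noteq> fst (fst R) \<and> newest ?U (fst c)" if "c \<in> set_option L" for c
    using inv w(2) that unfolding check_inv_def jdg_chans_def by auto
  have U: "gchans (\<Omega> \<union> ?\<Omega>) \<union> fst ` (set_option l \<union> {r}) \<subseteq> ?U \<union> {(w, 0), fst R}"
    using gchans_cut_link[of \<Sigma> A "(w, 0)" "Some (fst R)"] by auto
  have "\<exists>\<phi>. check_model \<Sigma> l r kl False pl pr L (\<Omega> \<union> ?\<Omega>) ((w, 0), A) i \<phi>" for i
  proof -
    obtain \<phi> where \<phi>: "check_model \<Sigma> l r kl kr pl pr L \<Omega> R i \<phi>"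
      using inv unfolding check_inv_def by blast
    let ?\<phi> = "\<phi>((w, 0) := if dep \<Sigma> A i then None else \<phi> (fst R))"
    have "check_model \<Sigma> l r kl False pl pr L (\<Omega> \<union> ?\<Omega>) ((w, 0), A) i ?\<phi>"
    proof (rule check_model_upd[OF \<phi> new])
      show "models i ?\<phi> ?\<Omega>"
        by (rule models_cut_link) (use R in auto)
      show "side_inv \<Sigma> Nu i (Some (snd r)) False pr ?\<phi> (Some ((w, 0), A))"
        by (rule side_inv_cut[of _ _ _ _ kr _ \<phi> "Some R"]) (use \<phi> in \<open>simp_all add: check_model_def\<close>)
      show "side_inv \<Sigma> Mu i (map_option snd l) kl pl ?\<phi> L"
        by (rule side_inv_upd_other) (use \<phi> L in \<open>fastforce simp: check_model_def\<close>)+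
    qed
    then show ?thesis by blast
  qed
  moreover have "newest (gchans (\<Omega> \<union> ?\<Omega>) \<union> fst ` (set_option l \<union> {r})) (w, 0)"
    by (rule newest_mono[OF _ U]) (use new R in \<open>(cases "fst R"; auto simp: newest_def)+\<close>)
  moreover have "newest (gchans (\<Omega> \<union> ?\<Omega>) \<union> fst ` (set_option l \<union> {r})) (fst c)"
    if "c \<in> set_option L" for c
    by (rule newest_mono[OF _ U, of "fst c"]) (use L[OF that] in \<open>(cases "fst R"; auto simp: newest_def)+\<close>)
  ultimately show ?thesis
    using L unfolding check_inv_def by simp
qed

lemma check_inv_cut_left:
  assumes inv: "check_inv \<Sigma> l r kl kr pl pr L \<Omega> R"
    and w: "w \<notin> fst ` fst ` (set_option l \<union> {r})" "w \<notin> jdg_chans (Jdg L \<Omega> Q R)"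
  shows "check_inv \<Sigma> l r False kr pl pr (Some ((w, 0), A))
    (\<Omega> \<union> cut_link \<Sigma> A (w, 0) (map_option fst L)) R"
proof -
  let ?U = "gchans \<Omega> \<union> fst ` (set_option l \<union> {r})"
    and ?\<Omega> = "cut_link \<Sigma> A (w, 0) (map_option fst L)"
  have new: "(w, g) \<notin> ?U" for g
    using w(1) gchans_fresh[OF w(2)] by (metis UnE fst_conv imageI jdg.sel(2))
  have R: "fst (fst R) \<noteq> w" "newest ?U (fst R)"
    using w(2) inv by (auto simp: jdg_chans_def check_inv_def)
  have L: "fst (fst c) \<noteq> w \<and> fst (fst c) \<noteq> fst (fst R)" if "c \<in> set_option L" for c
    using inv w(2) that unfolding check_inv_def jdg_chans_def by auto
  have U: "gchans (\<Omega> \<union> ?\<Omega>) \<union> fst ` (set_option l \<union> {r}) \<subseteq> ?U \<union> insert (w, 0) (fst ` set_option L)"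
    using gchans_cut_link[of \<Sigma> A "(w, 0)" "map_option fst L"] by (auto simp: option.set_map)
  have "\<exists>\<phi>. check_model \<Sigma> l r False kr pl pr (Some ((w, 0), A)) (\<Omega> \<union> ?\<Omega>) R i \<phi>" for i
  proof -
    obtain \<phi> where \<phi>: "check_model \<Sigma> l r kl kr pl pr L \<Omega> R i \<phi>"
      using inv unfolding check_inv_def by blast
    \<comment> \<open>If the left side is empty there is nothing to inherit: \<open>cut_link\<close>
      is empty and \<open>w\<close> stays unrelated at every priority.\<close>
    let ?\<phi> = "\<phi>((w, 0) := if dep \<Sigma> A i then None else Option.bind L (\<lambda>z. \<phi> (fst z)))"
    have "check_model \<Sigma> l r False kr pl pr (Some ((w, 0), A)) (\<Omega> \<union> ?\<Omega>) R i ?\<phi>"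
    proof (rule check_model_upd[OF \<phi> new])
      show "models i ?\<phi> ?\<Omega>"
        by (rule models_cut_link) (use L in \<open>cases L; fastforce\<close>)
      show "side_inv \<Sigma> Mu i (map_option snd l) False pl ?\<phi> (Some ((w, 0), A))"
        by (rule side_inv_cut[of _ _ _ _ kl _ \<phi> L]) (use \<phi> in \<open>simp_all add: check_model_def\<close>)
      show "side_inv \<Sigma> Nu i (Some (snd r)) kr pr ?\<phi> (Some R)"
        by (rule side_inv_upd_other) (use \<phi> R in \<open>auto simp: check_model_def\<close>)
    qed
    then show ?thesis by blast
  qed
  moreover have "newest (gchans (\<Omega> \<union> ?\<Omega>) \<union> fst ` (set_option l \<union> {r})) (w, 0)"
    by (rule newest_mono[OF _ U]) (use new L in \<open>auto simp: newest_def\<close>)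
  moreover have "newest (gchans (\<Omega> \<union> ?\<Omega>) \<union> fst ` (set_option l \<union> {r})) (fst R)"
    by (rule newest_mono[OF R(2) U]) (use R L in \<open>fastforce simp: newest_def\<close>)
  ultimately show ?thesis
    using R unfolding check_inv_def by simp
qed

lemma prio_eq: "\<Sigma> t = Some (p, a, A) \<Longrightarrow> prio \<Sigma> t = p"
  by (simp add: prio_def)

definition jdg_inv ::
  "('l, 't) sig \<Rightarrow> (gchan \<times> ('l, 't) tp) option \<Rightarrow> gchan \<times> ('l, 't) tp \<Rightarrow> bool \<Rightarrow> bool \<Rightarrow>
   nat set \<Rightarrow> nat set \<Rightarrow> ('l, 't, 'x) jdg \<Rightarrow> bool" where
  "jdg_inv \<Sigma> l r kl kr pl pr J \<longleftrightarrow> check_inv \<Sigma> l r kl kr pl pr (jleft J) (jrels J) (jright J)"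

text \<open>The freshness set holds the names of the start channels, so a cut cannot reintroduce one
  of them after it has left the judgment.\<close>

lemma jdg_inv_step:
  assumes "rule_inst \<Sigma> (fst ` fst ` (set_option l \<union> {r})) rl Js J" "J' |\<in>| Js"
    and "jdg_inv \<Sigma> l r kl kr pl pr J"
  shows "jdg_inv \<Sigma> l r (kl \<and> left_kept J J') (kr \<and> right_kept J J')
           (pl \<union> left_prios \<Sigma> [rl]) (pr \<union> right_prios \<Sigma> [rl]) J'"
proof -
  have *: "check_inv \<Sigma> l r kl kr pl pr (jleft J) (jrels J) (jright J)"
    using assms(3) by (simp add: jdg_inv_def)
  note defs = left_kept_def right_kept_def left_prios_def right_prios_def prio_eq jdg_inv_def
  from assms(1) show ?thesis
  proof cases
    case (ri_Cut w \<Gamma> \<Omega> P Q y C A)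
    let ?JQ = "Jdg (Some ((w, 0), A)) (\<Omega> \<union> cut_link \<Sigma> A (w, 0) (map_option fst \<Gamma>)) Q (y, C)"
    let ?JP = "Jdg \<Gamma> (\<Omega> \<union> cut_link \<Sigma> A (w, 0) (Some y)) P ((w, 0), A)"
    have w: "\<And>c. \<Gamma> = Some c \<Longrightarrow> fst (fst c) \<noteq> w" "fst y \<noteq> w"
      using ri_Cut(5) by (auto simp: jdg_chans_def)
    have prios: "left_prios \<Sigma> [rl] = {}" "right_prios \<Sigma> [rl] = {}"
      using ri_Cut(1) by (auto simp: left_prios_def right_prios_def)
    consider "J' = ?JP" | "J' = ?JQ" using assms(2) ri_Cut(2) by auto
    then show ?thesis
    proof cases
      case 1
      then have "left_kept J J'" "\<not> right_kept J J'"
        using ri_Cut(3) w by (auto simp: left_kept_def right_kept_def)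
      then show ?thesis
        using check_inv_cut_right[OF _ ri_Cut(4,5), where A = A] * 1 ri_Cut(3) prios
        by (simp add: jdg_inv_def)
    next
      case 2
      then have "\<not> left_kept J J'" "right_kept J J'"
        using ri_Cut(3) w by (cases \<Gamma>; force simp: left_kept_def right_kept_def)+
      then show ?thesis
        using check_inv_cut_left[OF _ ri_Cut(4,5), where A = A] * 2 ri_Cut(3) prios
        by (simp add: jdg_inv_def)
    qed
  next
    case (ri_PlusL Qs As x \<Omega> \<Delta>)
    have "\<forall>i. dep \<Sigma> (the (fmlookup As k)) i \<longrightarrow> dep \<Sigma> (Plus As) i" if "k |\<in>| fmdom As" for k
      using that by (auto simp: fmlookup_dom_iff intro: dep.intros)
    then show ?thesis
      using ri_PlusL assms(2) * by (auto simp: defs elim!: check_inv_same)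
  next
    case (ri_WithR Ps As \<Gamma> \<Omega> y)
    have "\<forall>i. dep \<Sigma> (the (fmlookup As k)) i \<longrightarrow> dep \<Sigma> (With As) i" if "k |\<in>| fmdom As" for k
      using that by (auto simp: fmlookup_dom_iff intro: dep.intros)
    then show ?thesis
      using ri_WithR assms(2) * by (auto simp: defs elim!: check_inv_same)
  next
    case (ri_MuR t i A \<Gamma> \<Omega> y \<beta> P)
    then show ?thesis
      using check_inv_right[of \<Sigma> l r kl kr pl pr \<Gamma> \<Omega> y \<beta> t, OF _ ri_MuR(4)] * assms(2) by (auto simp: defs unfold_rels_def)
  next
    case (ri_MuL t i A x \<alpha> \<Omega> Q \<Delta>)
    then show ?thesis
      using check_inv_left[of \<Sigma> l r kl kr pl pr x \<alpha> t \<Omega> \<Delta>, OF _ ri_MuL(4)] * assms(2) by (auto simp: defs unfold_rels_def Un_assoc)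
  next
    case (ri_NuR t i A \<Gamma> \<Omega> y \<beta> P)
    then show ?thesis
      using check_inv_right[of \<Sigma> l r kl kr pl pr \<Gamma> \<Omega> y \<beta> t, OF _ ri_NuR(4)] * assms(2) by (auto simp: defs unfold_rels_def Un_assoc)
  next
    case (ri_NuL t i A x \<alpha> \<Omega> Q \<Delta>)
    then show ?thesis
      using check_inv_left[of \<Sigma> l r kl kr pl pr x \<alpha> t \<Omega> \<Delta>, OF _ ri_NuL(4)] * assms(2) by (auto simp: defs unfold_rels_def)
  qed (use assms(2) * in \<open>auto simp: defs intro: dep.intros elim!: check_inv_same\<close>)
qed

section \<open>Lexicographic comparison along a path\<close>

definition prefix_all :: "nat \<Rightarrow> (nat \<Rightarrow> bool) \<Rightarrow> bool" where
  "prefix_all m E \<longleftrightarrow> (\<forall>k<m. E (Suc k))"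

definition prefix_lex :: "nat \<Rightarrow> (nat \<Rightarrow> bool) \<Rightarrow> (nat \<Rightarrow> bool) \<Rightarrow> bool" where
  "prefix_lex m E L \<longleftrightarrow> (\<exists>k<m. prefix_all k E \<and> L (Suc k))"

text \<open>The three cases of \<open>call_less\<close> with arbitrary predicates for equality and
  decrease. This detaches the comparison from any constraint set, so that results of different
  checks can be composed.\<close>

definition precedes ::
  "('l, 't) sig \<Rightarrow> (nat \<Rightarrow> 'x rel) \<Rightarrow> 'x \<Rightarrow> 'x \<Rightarrow> (nat \<Rightarrow> bool) \<Rightarrow> (nat \<Rightarrow> bool) \<Rightarrow> bool" where
  "precedes \<Sigma> ord Y X E L \<longleftrightarrow>
     (\<exists>i\<le>lowest \<Sigma>. (Y, X) \<in> ord i \<and> Y \<noteq> X \<and> (prefix_lex i E L \<or> prefix_all i E)) \<or>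
     (Y = X \<and> prefix_lex (lowest \<Sigma>) E L) \<or>
     (\<exists>i\<le>lowest \<Sigma>. \<exists>j\<le>lowest \<Sigma>. Y \<in> Field (ord i) \<and> X \<in> Field (ord j) \<and>
        prefix_lex (min i j) E L)"

lemma prefix_all_mono: "prefix_all m E \<Longrightarrow> k \<le> m \<Longrightarrow> prefix_all k E"
  by (simp add: prefix_all_def)

lemma prefix_lex_mono: "prefix_lex m E L \<Longrightarrow> m \<le> n \<Longrightarrow> prefix_lex n E L"
  unfolding prefix_lex_def by (meson order_less_le_trans)

lemma prefix_lex_cases: "prefix_lex m E L \<Longrightarrow> prefix_lex n E L \<or> prefix_all n E"
  unfolding prefix_lex_def by (meson not_le prefix_all_mono)

text \<open>Unprimed predicates belong to the first stretch, primed ones to the second, doubly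
  primed ones to the composite. The four laws are instantiated later by the composition lemmas for
  \<open>side_eq\<close> and \<open>side_less\<close>.\<close>

context
  fixes E E' E'' L L' L'' :: "nat \<Rightarrow> bool"
  assumes EE: "\<And>i. E i \<Longrightarrow> E' i \<Longrightarrow> E'' i" and EL: "\<And>i. E i \<Longrightarrow> L' i \<Longrightarrow> L'' i"
    and LE: "\<And>i. L i \<Longrightarrow> E' i \<Longrightarrow> L'' i" and LL: "\<And>i. L i \<Longrightarrow> L' i \<Longrightarrow> L'' i"
begin

lemma prefix_all_all: "prefix_all m E \<Longrightarrow> prefix_all m E' \<Longrightarrow> prefix_all m E''"
  using EE by (simp add: prefix_all_def)

lemma prefix_all_lex:
  assumes "prefix_all m E" "prefix_lex n E' L'" "n \<le> m" shows "prefix_lex n E'' L''"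
proof -
  obtain k where k: "k < n" "prefix_all k E'" "L' (Suc k)"
    using assms(2) by (auto simp: prefix_lex_def)
  then have "E (Suc k)" "prefix_all k E"
    using assms(1,3) by (auto simp: prefix_all_def)
  then show ?thesis
    using k EL prefix_all_all unfolding prefix_lex_def by blast
qed

lemma prefix_lex_all:
  assumes "prefix_lex n E L" "prefix_all m E'" "n \<le> m" shows "prefix_lex n E'' L''"
proof -
  obtain k where k: "k < n" "prefix_all k E" "L (Suc k)"
    using assms(1) by (auto simp: prefix_lex_def)
  then have "E' (Suc k)" "prefix_all k E'"
    using assms(2,3) by (auto simp: prefix_all_def)
  then show ?thesis
    using k LE prefix_all_all unfolding prefix_lex_def by blast
qed

text \<open>With decreases at \<open>k\<close> and \<open>k'\<close> the composite decreases at
  \<open>min k k'\<close>: before it both stretches are equal, and there one decreases while the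
  other is equal or decreases too.\<close>

lemma prefix_lex_lex:
  assumes "prefix_lex m E L" "prefix_lex n E' L'" shows "prefix_lex (min m n) E'' L''"
proof -
  obtain k where k: "k < m" "prefix_all k E" "L (Suc k)"
    using assms(1) by (auto simp: prefix_lex_def)
  obtain k' where k': "k' < n" "prefix_all k' E'" "L' (Suc k')"
    using assms(2) by (auto simp: prefix_lex_def)
  have E: "E (Suc j)" if "j < k" for j using that k by (simp add: prefix_all_def)
  have E': "E' (Suc j)" if "j < k'" for j using that k' by (simp add: prefix_all_def)
  have "prefix_all (min k k') E''"
    using E E' EE by (simp add: prefix_all_def)
  moreover have "L'' (Suc (min k k'))"
    using k(3) k'(3) E[of k'] E'[of k] EL LE LL by (cases k k' rule: linorder_cases) auto
  ultimately show ?thesis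
    using k(1) k'(1) unfolding prefix_lex_def by (intro exI[of _ "min k k'"]) auto
qed

text \<open>Disjoint domains force both comparisons to place \<open>Y\<close> in the same order, so
  the points up to which the lists are compared fit together.\<close>

lemma precedes_trans:
  assumes ord: "order_family \<Sigma> \<P> ord"
    and YX: "precedes \<Sigma> ord Y X E L" and ZY: "precedes \<Sigma> ord Z Y E' L'"
  shows "precedes \<Sigma> ord Z X E'' L''"
proof -
  let ?n = "lowest \<Sigma>"
  have uniq: "i = j" if "x \<in> Field (ord i)" "x \<in> Field (ord j)" "i \<le> ?n" "j \<le> ?n" for x i j
    using ord that unfolding order_family_def by blast
  have po: "trans (ord i)" "antisym (ord i)" if "i \<le> ?n" for i
    using ord that unfolding order_family_def partial_order_on_def preorder_on_def by auto
  have lex: "prefix_lex k E'' L''" if "prefix_lex m E L" "prefix_lex n E' L'" "min m n \<le> k" for k m n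
    using prefix_lex_lex[OF that(1,2)] that(3) prefix_lex_mono by blast
  from YX consider
    (ord) i where "i \<le> ?n" "(Y, X) \<in> ord i" "Y \<noteq> X" "prefix_lex i E L \<or> prefix_all i E"
  | (same) "Y = X" "prefix_lex ?n E L"
  | (lex) i j where "i \<le> ?n" "j \<le> ?n" "Y \<in> Field (ord i)" "X \<in> Field (ord j)" "prefix_lex (min i j) E L"
    unfolding precedes_def by blast
  note casesYX = this
  from ZY consider
    (ord) i where "i \<le> ?n" "(Z, Y) \<in> ord i" "Z \<noteq> Y" "prefix_lex i E' L' \<or> prefix_all i E'"
  | (same) "Z = Y" "prefix_lex ?n E' L'"
  | (lex) i j where "i \<le> ?n" "j \<le> ?n" "Z \<in> Field (ord i)" "Y \<in> Field (ord j)" "prefix_lex (min i j) E' L'"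
    unfolding precedes_def by blast
  then show ?thesis
  proof cases
    case ZY: (ord i)
    from casesYX show ?thesis
    proof cases
      case YX: (ord j)
      have [simp]: "j = i" using uniq[of Y i j] ZY(1,2) YX(1,2) by (auto simp: Field_def)
      \<comment> \<open>If \<open>Z = X\<close>, antisymmetry would identify \<open>Y\<close> with
        them.\<close>
      have "(Z, X) \<in> ord i" "Z \<noteq> X"
        using po[of i] ZY(1-3) YX(2,3) by (auto dest: transD antisymD)
      moreover have "prefix_lex i E'' L'' \<or> prefix_all i E''"
        using ZY(4) YX(4) lex[of i i i] prefix_all_all[of i] prefix_all_lex[of i i] prefix_lex_all[of i i] by auto
      ultimately show ?thesis
        using ZY(1) unfolding precedes_def by blast
    next
      case same
      then have "prefix_lex i E L \<or> prefix_all i E" using prefix_lex_cases by blast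
      then have "prefix_lex i E'' L'' \<or> prefix_all i E''"
        using ZY(4) lex[of i i i] prefix_all_all[of i] prefix_all_lex[of i i] prefix_lex_all[of i i] by auto
      then show ?thesis
        using ZY same unfolding precedes_def by blast
    next
      case YX: (lex j k)
      have [simp]: "j = i" using uniq[of Y i j] ZY(1,2) YX by (auto simp: Field_def)
      have "prefix_lex (min i k) E'' L''"
        using ZY(4) YX(5) lex[of "min i k" i "min i k"] prefix_lex_all[of "min i k" i] by auto
      moreover have "Z \<in> Field (ord i)" using ZY(2) by (auto simp: Field_def)
      ultimately show ?thesis
        using ZY(1) YX unfolding precedes_def by blast
    qed
  next
    case ZY: same
    from casesYX show ?thesis
    proof cases
      case YX: (ord i)
      have "prefix_lex i E' L' \<or> prefix_all i E'" using ZY(2) prefix_lex_cases by blast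
      then have "prefix_lex i E'' L'' \<or> prefix_all i E''"
        using YX(4) lex[of i i i] prefix_all_all[of i] prefix_all_lex[of i i] prefix_lex_all[of i i] by auto
      then show ?thesis
        using YX ZY unfolding precedes_def by blast
    next
      case YX: same
      then show ?thesis
        using ZY lex[of ?n ?n ?n] unfolding precedes_def by auto
    next
      case YX: (lex i j)
      then have "prefix_lex (min i j) E'' L''"
        using ZY lex[of "min i j" ?n "min i j"] by auto
      then show ?thesis
        using YX ZY unfolding precedes_def by blast
    qed
  next
    case ZY: (lex i j)
    from casesYX show ?thesis
    proof cases
      case YX: (ord k)
      have [simp]: "k = j" using uniq[of Y k j] ZY YX(1,2) by (auto simp: Field_def)
      have "prefix_lex (min i j) E'' L''"
        using ZY(5) YX(4) lex[of j "min i j" "min i j"] prefix_all_lex[of j "min i j"] by auto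
      moreover have "X \<in> Field (ord j)" using YX(2) by (auto simp: Field_def)
      ultimately show ?thesis
        using ZY unfolding precedes_def by blast
    next
      case YX: same
      then have "prefix_lex (min i j) E'' L''"
        using ZY lex[of ?n "min i j" "min i j"] by auto
      then show ?thesis
        using YX ZY unfolding precedes_def by blast
    next
      case YX: (lex k m)
      have "prefix_lex (min i m) E'' L''"
        by (rule lex[OF YX(5) ZY(5)]) linarith
      then show ?thesis
        using YX ZY unfolding precedes_def by blast
    qed
  qed
qed

end

section \<open>Comparing two process calls\<close>

definition left_type :: "('l, 't, 'x) pdef \<Rightarrow> ('l, 't) tp option" where
  "left_type d = map_option snd (pleft d)"

definition right_type :: "('l, 't, 'x) pdef \<Rightarrow> ('l, 't) tp option" where
  "right_type d = Some (snd (pright d))"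

definition calls_eq ::
  "('l, 't) sig \<Rightarrow> ('l, 't, 'x) pdef \<Rightarrow> ('l, 't, 'x) pdef \<Rightarrow> bool \<Rightarrow> bool \<Rightarrow> nat set \<Rightarrow> nat set \<Rightarrow>
   nat \<Rightarrow> bool" where
  "calls_eq \<Sigma> d d' kl kr pl pr i \<longleftrightarrow>
     side_eq \<Sigma> i (left_type d) (left_type d') kl pl \<and>
     side_eq \<Sigma> i (right_type d) (right_type d') kr pr"

text \<open>Forgets which channel comes first in an entry of \<open>chan_list\<close>: the polarity
  condition in \<open>side_less\<close> admits left decreases only at positive and right decreases
  only at negative priorities.\<close>

definition calls_less ::
  "('l, 't) sig \<Rightarrow> ('l, 't, 'x) pdef \<Rightarrow> ('l, 't, 'x) pdef \<Rightarrow> bool \<Rightarrow> bool \<Rightarrow> nat set \<Rightarrow> nat set \<Rightarrow>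
   nat \<Rightarrow> bool" where
  "calls_less \<Sigma> d d' kl kr pl pr i \<longleftrightarrow>
     side_less \<Sigma> Mu i (left_type d) (left_type d') kl pl \<or>
     side_less \<Sigma> Nu i (right_type d) (right_type d') kr pr"

definition call_precedes ::
  "('l, 't) sig \<Rightarrow> (nat \<Rightarrow> 'x rel) \<Rightarrow> ('l, 't, 'x) pdef \<Rightarrow> ('l, 't, 'x) pdef \<Rightarrow> bool \<Rightarrow> bool \<Rightarrow>
   nat set \<Rightarrow> nat set \<Rightarrow> bool" where
  "call_precedes \<Sigma> ord d' d kl kr pl pr \<longleftrightarrow>
     precedes \<Sigma> ord (pname d') (pname d)
       (calls_eq \<Sigma> d d' kl kr pl pr) (calls_less \<Sigma> d d' kl kr pl pr)"

lemma polarity_unique: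
  "wf_sig \<Sigma> \<Longrightarrow> has_polarity \<Sigma> i a \<Longrightarrow> has_polarity \<Sigma> i b \<Longrightarrow> a = b"
  unfolding wf_sig_def has_polarity_def by blast

lemma side_less_polarity: "side_less \<Sigma> a i S T k ps \<Longrightarrow> has_polarity \<Sigma> i a"
  by (auto simp: side_less_def level_less_def)

lemma call_precedes_trans:
  assumes "wf_sig \<Sigma>" "order_family \<Sigma> \<P> ord"
    and 1: "call_precedes \<Sigma> ord d' d kl kr pl pr"
    and 2: "call_precedes \<Sigma> ord d'' d' kl' kr' pl' pr'"
  shows "call_precedes \<Sigma> ord d'' d (kl \<and> kl') (kr \<and> kr') (pl \<union> pl') (pr \<union> pr')"
  unfolding call_precedes_def
proof (rule precedes_trans[OF _ _ _ _ assms(2) 1[unfolded call_precedes_def] 2[unfolded call_precedes_def]])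
  \<comment> \<open>Decreases on different sides cannot meet at one priority, since it would have
    both polarities.\<close>
  fix i
  assume "calls_less \<Sigma> d d' kl kr pl pr i" "calls_less \<Sigma> d' d'' kl' kr' pl' pr' i"
  then show "calls_less \<Sigma> d d'' (kl \<and> kl') (kr \<and> kr') (pl \<union> pl') (pr \<union> pr') i"
    unfolding calls_less_def
    using side_less_trans side_less_polarity polarity_unique[OF assms(1)] by (metis polarity.distinct(1))
qed (auto simp: calls_eq_def calls_less_def
    intro: side_eq_trans side_eq_less_trans side_less_eq_trans)

section \<open>Following a cycle through the checks\<close>

definition start_left :: "('l, 't, 'x) pdef \<Rightarrow> (gchan \<times> ('l, 't) tp) option" where
  "start_left d = map_option (\<lambda>(x, A). ((x, 0), A)) (pleft d)"

definition start_right :: "('l, 't, 'x) pdef \<Rightarrow> gchan \<times> ('l, 't) tp" where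
  "start_right d = ((fst (pright d), 0), snd (pright d))"

lemma start_types:
  "map_option snd (start_left d) = left_type d" "Some (snd (start_right d)) = right_type d"
  by (auto simp: start_left_def start_right_def left_type_def right_type_def option.map_comp
      comp_def case_prod_unfold)

text \<open>Start channels have rank 0, so a derivable equality forces rank 0 on the current channel
  and a derivable decrease a positive rank; the invariant turns these ranks into statements on the
  stretch.\<close>

lemma call_precedes_call:
  assumes inv: "jdg_inv \<Sigma> (start_left d) (start_right d) kl kr pl pr J" and call: "call_of d' J"
    and less: "call_less \<Sigma> ord (jrels J)
      (pname d', chan_list \<Sigma> (map_option fst (jleft J)) (fst (jright J)))
      (pname d, chan_list \<Sigma> (map_option fst (start_left d)) (fst (start_right d)))"
  shows "call_precedes \<Sigma> ord d' d kl kr pl pr"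
proof -
  let ?\<Omega> = "jrels J" and ?x = "map_option fst (jleft J)" and ?y = "fst (jright J)"
  let ?u = "map_option fst (start_left d)" and ?v = "fst (start_right d)"
  let ?es = "chan_list \<Sigma> ?x ?y" and ?fs = "chan_list \<Sigma> ?u ?v"
  let ?E = "calls_eq \<Sigma> d d' kl kr pl pr" and ?L = "calls_less \<Sigma> d d' kl kr pl pr"
  have types: "left_type d' = map_option snd (jleft J)" "right_type d' = Some (snd (jright J))"
    using call by (auto simp: call_of_def left_type_def right_type_def)
  have left_eq: "side_eq \<Sigma> i (left_type d) (left_type d') kl pl" if eq: "rel_option (ch_eq ?\<Omega> i) ?x ?u" for i
  proof -
    obtain \<phi> where \<phi>: "check_model \<Sigma> (start_left d) (start_right d) kl kr pl pr (jleft J) ?\<Omega> (jright J) i \<phi>"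
      using inv unfolding jdg_inv_def check_inv_def by blast
    show ?thesis
    proof (cases "jleft J")
      case None
      then have "start_left d = None" using that by (cases "start_left d") auto
      then show ?thesis
        using None unfolding types unfolding start_types(1)[symmetric] by (simp add: side_eq_def)
    next
      case (Some c)
      then obtain e where e: "start_left d = Some e" "ch_eq ?\<Omega> i (fst c) (fst e)"
        using eq Some by (cases "start_left d") auto
      have "\<phi> (fst c) = Some 0"
        using models_ch_eq[of i \<phi>, OF _ e(2)] \<phi> e(1) by (simp add: check_model_def)
      then show ?thesis
        using \<phi> Some unfolding types unfolding start_types(1)[symmetric]
        by (cases c) (simp add: check_model_def side_inv_Some)
    qed
  qed
  have right_eq: "side_eq \<Sigma> i (right_type d) (right_type d') kr pr" if "ch_eq ?\<Omega> i ?y ?v" for i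
  proof -
    obtain \<phi> where \<phi>: "check_model \<Sigma> (start_left d) (start_right d) kl kr pl pr (jleft J) ?\<Omega> (jright J) i \<phi>"
      using inv unfolding jdg_inv_def check_inv_def by blast
    have "\<phi> ?y = Some 0"
      using models_ch_eq[of i \<phi>, OF _ that] \<phi> by (simp add: check_model_def)
    then show ?thesis
      using \<phi> unfolding types unfolding start_types(2)[symmetric]
      by (cases "jright J") (simp add: check_model_def side_inv_Some)
  qed
  have left_less: "side_less \<Sigma> Mu i (left_type d) (left_type d') kl pl" if less: "opt_less ?\<Omega> i ?x ?u" for i
  proof -
    obtain \<phi> where \<phi>: "check_model \<Sigma> (start_left d) (start_right d) kl kr pl pr (jleft J) ?\<Omega> (jright J) i \<phi>"
      using inv unfolding jdg_inv_def check_inv_def by blast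
    obtain c e where ce: "jleft J = Some c" "start_left d = Some e" "ch_less ?\<Omega> i (fst c) (fst e)"
      using less unfolding opt_less_def by auto
    have "rank_less (\<phi> (fst c)) (Some 0)"
      using models_ch_less[of i \<phi>, OF _ ce(3)] \<phi> ce(2) by (simp add: check_model_def)
    then obtain n where "n > 0" "\<phi> (fst c) = Some n"
      by (auto simp: rank_less_def)
    then show ?thesis
      using \<phi> ce(1) unfolding types unfolding start_types(1)[symmetric]
      by (cases c) (simp add: check_model_def side_inv_Some)
  qed
  have right_less: "side_less \<Sigma> Nu i (right_type d) (right_type d') kr pr" if less: "opt_less ?\<Omega> i (Some ?y) (Some ?v)" for i
  proof -
    obtain \<phi> where \<phi>: "check_model \<Sigma> (start_left d) (start_right d) kl kr pl pr (jleft J) ?\<Omega> (jright J) i \<phi>"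
      using inv unfolding jdg_inv_def check_inv_def by blast
    have "rank_less (\<phi> ?y) (Some 0)"
      using models_ch_less[of i \<phi> ?\<Omega> ?y ?v] less \<phi> by (simp add: check_model_def opt_less_def)
    then obtain n where "n > 0" "\<phi> ?y = Some n"
      by (auto simp: rank_less_def)
    then show ?thesis
      using \<phi> unfolding types unfolding start_types(2)[symmetric]
      by (cases "jright J") (simp add: check_model_def side_inv_Some)
  qed
  have nth: "chan_list \<Sigma> x y ! k = (if has_polarity \<Sigma> (Suc k) Mu then (x, Some y) else (Some y, x))"
    if "k < lowest \<Sigma>" for k x y
    using that by (simp add: chan_list_def del: upt_Suc)
  have E: "?E (Suc k)" if "entry_eq ?\<Omega> (Suc k) (?es ! k) (?fs ! k)" "k < lowest \<Sigma>" for k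
    using that left_eq right_eq by (auto simp: nth entry_eq_def calls_eq_def split: if_splits)
  have L: "?L (Suc k)" if "entry_less ?\<Omega> (Suc k) (?es ! k) (?fs ! k)" "k < lowest \<Sigma>" for k
    using that left_less right_less by (auto simp: nth entry_less_def calls_less_def split: if_splits)
  have all: "prefix_all m ?E" if "prefix_eq ?\<Omega> m ?es ?fs" "m \<le> lowest \<Sigma>" for m
    using that E by (auto simp: prefix_eq_def prefix_all_def)
  have lex: "prefix_lex m ?E ?L" if "prefix_less ?\<Omega> m ?es ?fs" "m \<le> lowest \<Sigma>" for m
    using that all L unfolding prefix_less_def prefix_lex_def by (meson le_trans less_imp_le order_less_le_trans)
  have min: "min i j \<le> lowest \<Sigma>" if "i \<le> lowest \<Sigma>" for i j
    using that by linarith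
  show ?thesis
    using less unfolding call_less_def call_precedes_def precedes_def split
    by (blast intro: all lex min)
qed

section \<open>Running a check alongside a derivation\<close>

lemma rule_inst_not_Call: "rule_inst \<Sigma> N r Js J \<Longrightarrow> jproc J \<noteq> Call X"
  by (induction rule: rule_inst.induct) auto

lemma cut_kept:
  assumes "w \<notin> jdg_chans (Jdg \<Gamma> \<Omega> R (y, C))"
  shows "left_kept (Jdg \<Gamma> \<Omega> R (y, C)) (Jdg \<Gamma> \<Omega>' P ((w, 0), A))"
    "\<not> right_kept (Jdg \<Gamma> \<Omega> R (y, C)) (Jdg \<Gamma> \<Omega>' P ((w, 0), A))"
    "\<not> left_kept (Jdg \<Gamma> \<Omega> R (y, C)) (Jdg (Some ((w, 0), A)) \<Omega>' P (y, C))"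
    "right_kept (Jdg \<Gamma> \<Omega> R (y, C)) (Jdg (Some ((w, 0), A)) \<Omega>' P (y, C))"
  using assms by (auto simp: left_kept_def right_kept_def jdg_chans_def)

text \<open>Cut types and choice types may differ between the two instances, so a check need not have the
  types and constraints of the infinitary derivation; it suffices that it applies the same rules.\<close>

lemma rule_inst_match:
  assumes "rule_inst \<Sigma> N rl Js J" "J1 |\<in>| Js" "rule_inst \<Sigma> N' rl' Js' J'" "jproc J' = jproc J"
  shows "rl' = rl \<and> (\<exists>J1' |\<in>| Js'. jproc J1' = jproc J1 \<and>
    (left_kept J' J1' \<longleftrightarrow> left_kept J J1) \<and> (right_kept J' J1' \<longleftrightarrow> right_kept J J1))"
  using assms(1)
proof cases
  case (ri_Cut w \<Gamma> \<Omega> P Q y C A)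
  from assms(3) show ?thesis
    using assms(2,4) ri_Cut by cases (auto simp: cut_kept)
next
  case (ri_PlusL Qs As x \<Omega> \<Delta>)
  from assms(3) show ?thesis
    using assms(2,4) ri_PlusL by cases (auto simp: left_kept_def right_kept_def)
next
  case (ri_WithR Ps As \<Gamma> \<Omega> y)
  from assms(3) show ?thesis
    using assms(2,4) ri_WithR by cases (auto simp: left_kept_def right_kept_def)
qed (use assms(3) in cases, use assms(2,4) in \<open>auto simp: left_kept_def right_kept_def\<close>)+

lemma left_kept_trans: "left_kept J J' \<Longrightarrow> left_kept J' J'' \<Longrightarrow> left_kept J J''"
  by (simp add: left_kept_def)

lemma right_kept_trans: "right_kept J J' \<Longrightarrow> right_kept J' J'' \<Longrightarrow> right_kept J J''"
  by (simp add: right_kept_def)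

lemma left_prios_Cons: "left_prios \<Sigma> (r # rs) = left_prios \<Sigma> [r] \<union> left_prios \<Sigma> rs"
  by (auto simp: left_prios_def)

lemma right_prios_Cons: "right_prios \<Sigma> (r # rs) = right_prios \<Sigma> [r] \<union> right_prios \<Sigma> rs"
  by (auto simp: right_prios_def)

lemma prios_RDef [simp]: "left_prios \<Sigma> [RDef X] = {}" "right_prios \<Sigma> [RDef X] = {}"
  by (auto simp: left_prios_def right_prios_def)

lemma jdg_inv_start:
  assumes "wf_program \<Sigma> \<P>" "d \<in> fst \<P>"
  shows "jdg_inv \<Sigma> (start_left d) (start_right d) True True {} {}
    (Jdg (start_left d) {} (pbody d) (start_right d))"
  unfolding jdg_inv_def jdg.sel
  by (rule check_inv_start)
    (use assms in \<open>fastforce simp: wf_program_def start_left_def start_right_def split: prod.splits\<close>)+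

lemma checks_start:
  assumes "locally_valid \<Sigma> ord \<P>" "d \<in> fst \<P>"
  shows "checks \<Sigma> (fst \<P>) ord (map_option fst (start_left d)) (pname d) (fst (start_right d))
    (Jdg (start_left d) {} (pbody d) (start_right d))"
  using assms unfolding locally_valid_def Let_def start_left_def start_right_def by auto

text \<open>Induction along the path, accompanied by the judgment \<open>J\<close> of the current
  check, which is tied to the derivation only by its process term. At a call the current check ends,
  that of the called definition starts, and transitivity joins the stretches. Only implications from
  the flags are claimed: two empty left sides may agree although a channel came and went in
  between.\<close>

lemma path_precedes:
  assumes wf: "wf_sig \<Sigma>" "wf_program \<Sigma> \<P>" "order_family \<Sigma> \<P> ord"
    and valid: "locally_valid \<Sigma> ord \<P>"
    and "path D rs D'"
    and "is_deriv \<Sigma> (fst \<P>) N D" "d \<in> fst \<P>"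
    and "checks \<Sigma> (fst \<P>) ord (map_option fst (start_left d)) (pname d) (fst (start_right d)) J"
    and "jproc J = jproc (dconcl D)"
    and "jdg_inv \<Sigma> (start_left d) (start_right d) kl kr pl pr J"
    and "jproc (dconcl D') = Call Z"
  shows "\<exists>d' \<in> fst \<P>. pname d' = Z \<and> (\<exists>kl' kr'.
    (kl' \<longrightarrow> left_kept (dconcl D) (dconcl D')) \<and> (kr' \<longrightarrow> right_kept (dconcl D) (dconcl D')) \<and>
    call_precedes \<Sigma> ord d' d (kl \<and> kl') (kr \<and> kr')
      (pl \<union> left_prios \<Sigma> rs) (pr \<union> right_prios \<Sigma> rs))"
  using assms(5-)
proof (induction arbitrary: N d J kl kr pl pr rule: path.induct)
  case (1 D)
  from 1(3) show ?case
  proof cases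
    case (ch_rule r Js)
    then show ?thesis using rule_inst_not_Call 1 by metis
  next
    case (ch_Call d')
    have "pname d' = Z" using ch_Call(2) 1 by (simp add: call_of_def)
    moreover have "call_precedes \<Sigma> ord d' d kl kr pl pr"
      by (rule call_precedes_call[OF 1(5) ch_Call(2,3)])
    ultimately show ?thesis
      using ch_Call(1) by (intro bexI[of _ d'] conjI exI[of _ True])
        (auto simp: left_kept_def right_kept_def left_prios_def right_prios_def)
  qed
next
  case (2 D1 D rs D')
  from 2(4) show ?case
  proof cases
    case (id_rule r Ds J0)
    have J0: "dconcl D = J0" "dprems D = Ds" "drule D = r" using id_rule(1) by auto
    \<comment> \<open>The check cannot end here, as \<open>J\<close> has the process term of a
      conclusion of a rule that is not for calls.\<close>
    have "\<not> call_of d' J" for d'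
      using rule_inst_not_Call[OF id_rule(2)] 2(7) J0(1) by (auto simp: call_of_def)
    then obtain r' Js where chk: "rule_inst \<Sigma> (fst ` (set_option (map_option fst (start_left d)) \<union> {fst (start_right d)})) r' Js J"
      "\<forall>J'. J' |\<in>| Js \<longrightarrow> checks \<Sigma> (fst \<P>) ord (map_option fst (start_left d)) (pname d) (fst (start_right d)) J'"
      using 2(6) by (auto elim: checks.cases)
    have "dconcl D1 |\<in>| dconcl |`| Ds" using 2(1) J0 by auto
    from rule_inst_match[OF id_rule(2) this chk(1)] 2(7) J0
    obtain J1 where r': "r' = r" and J1: "J1 |\<in>| Js" "jproc J1 = jproc (dconcl D1)"
      "left_kept J J1 \<longleftrightarrow> left_kept J0 (dconcl D1)" "right_kept J J1 \<longleftrightarrow> right_kept J0 (dconcl D1)"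
      by auto
    have N: "fst ` (set_option (map_option fst (start_left d)) \<union> {fst (start_right d)}) =
        fst ` fst ` (set_option (start_left d) \<union> {start_right d})"
      by (auto simp: option.set_map)
    have D1: "is_deriv \<Sigma> (fst \<P>) (N \<union> jdg_chans J0) D1"
      using id_rule(3) 2(1) J0 by auto
    obtain d' kl' kr' where *: "d' \<in> fst \<P>" "pname d' = Z"
      "kl' \<longrightarrow> left_kept (dconcl D1) (dconcl D')" "kr' \<longrightarrow> right_kept (dconcl D1) (dconcl D')"
      "call_precedes \<Sigma> ord d' d ((kl \<and> left_kept J J1) \<and> kl') ((kr \<and> right_kept J J1) \<and> kr')
        ((pl \<union> left_prios \<Sigma> [r]) \<union> left_prios \<Sigma> rs) ((pr \<union> right_prios \<Sigma> [r]) \<union> right_prios \<Sigma> rs)"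
      using 2(3)[OF D1 2(5) chk(2)[rule_format, OF J1(1)] J1(2)
          jdg_inv_step[OF chk(1)[unfolded N r'] J1(1) 2(8)] 2(9)] by blast
    have "left_kept J J1 \<and> kl' \<Longrightarrow> left_kept (dconcl D) (dconcl D')"
      "right_kept J J1 \<and> kr' \<Longrightarrow> right_kept (dconcl D) (dconcl D')"
      using *(3,4) J1(3,4) J0(1) left_kept_trans right_kept_trans by metis+
    then show ?thesis
      using *(1,2,5) J0(3)
      by (intro bexI[of _ d'] conjI exI[of _ "left_kept J J1 \<and> kl'"] exI[of _ "right_kept J J1 \<and> kr'"])
        (auto simp: left_prios_Cons[of _ r rs] right_prios_Cons[of _ r rs] Un_assoc conj_assoc)
  next
    case (id_Def e J0 D0)
    have D: "dconcl D = J0" "D1 = D0" "drule D = RDef (pname e)" using id_Def(1) 2(1) by auto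
    have call: "jproc J = Call (pname e)" using id_Def(3) 2(7) D by (simp add: call_of_def)
    from 2(6) have "call_precedes \<Sigma> ord e d kl kr pl pr"
    proof cases
      case (ch_rule r Js)
      then show ?thesis using rule_inst_not_Call call by metis
    next
      case (ch_Call e')
      have "pname e' = pname e" using ch_Call(2) call by (simp add: call_of_def)
      then have "e' = e"
        using wf(2) ch_Call(1) id_Def(2) by (auto simp: wf_program_def dest: inj_onD)
      then show ?thesis using call_precedes_call[OF 2(8) ch_Call(2,3)] by simp
    qed
    note e = this
    have J: "jproc (Jdg (start_left e) {} (pbody e) (start_right e)) = jproc (dconcl D1)"
      using id_Def(4) D by simp
    \<comment> \<open>The restarted check begins with both flags set and no priorities.\<close>
    obtain d' kl' kr' where *: "d' \<in> fst \<P>" "pname d' = Z"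
      "kl' \<longrightarrow> left_kept (dconcl D1) (dconcl D')" "kr' \<longrightarrow> right_kept (dconcl D1) (dconcl D')"
      "call_precedes \<Sigma> ord d' e (True \<and> kl') (True \<and> kr') ({} \<union> left_prios \<Sigma> rs) ({} \<union> right_prios \<Sigma> rs)"
      using 2(3)[OF id_Def(5)[folded D(2)] id_Def(2) checks_start[OF valid id_Def(2)] J
          jdg_inv_start[OF wf(2) id_Def(2)] 2(9)] by blast
    have "left_kept (dconcl D) (dconcl D1)" "right_kept (dconcl D) (dconcl D1)"
      using id_Def(4) D by (auto simp: left_kept_def right_kept_def)
    then have "kl' \<Longrightarrow> left_kept (dconcl D) (dconcl D')" "kr' \<Longrightarrow> right_kept (dconcl D) (dconcl D')"
      using *(3,4) left_kept_trans right_kept_trans by metis+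
    then show ?thesis
      using *(1,2) call_precedes_trans[OF wf(1,3) e *(5)] D(3)
      by (intro bexI[of _ d'] conjI exI[of _ kl'] exI[of _ kr'])
        (auto simp: left_prios_Cons[of _ "RDef (pname e)" rs] right_prios_Cons[of _ "RDef (pname e)" rs])
  qed
qed

text \<open>On a cycle both ends have the same type, so a strict decrease at priority \<open>i\<close> excludes that
  the channel was replaced, and equality at the higher priorities excludes rules of these
  priorities.\<close>

lemma side_less_cycle:
  assumes "side_less \<Sigma> a i S S k ps" "\<And>j. 1 \<le> j \<Longrightarrow> j < i \<Longrightarrow> side_eq \<Sigma> j S S k ps"
    and "0 \<notin> ps" "finite ps"
  shows "S \<noteq> None \<and> k \<and> ps \<noteq> {} \<and> has_polarity \<Sigma> (Min ps) a"
proof -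
  have k: "S \<noteq> None" k "i \<in> ps" "has_polarity \<Sigma> i a"
    using assms(1) by (auto simp: side_less_def level_less_def split: if_splits)
  \<comment> \<open>Since \<open>k\<close> holds, equality at \<open>j\<close> excludes
    \<open>j\<close>; priority 0, which the comparison does not reach, is excluded by
    assumption.\<close>
  have "j \<notin> ps" if "j < i" for j
  proof (cases j)
    case 0
    then show ?thesis using assms(3) by simp
  next
    case (Suc n)
    then show ?thesis
      using assms(2)[of j] that k(1,2) by (auto simp: side_eq_def level_eq_def)
  qed
  then have "Min ps = i"
    using k(3) assms(4) by (intro Min_eqI) (auto simp: not_less[symmetric])
  then show ?thesis using k by auto
qed

text \<open>\<open>prio\<close> is unspecified on undefined type variables, but the rules of a
  derivation unfold only defined ones, whose priorities start at 1.\<close>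

lemma path_prios:
  assumes "wf_sig \<Sigma>" "path D rs D'" "is_deriv \<Sigma> V N D"
  shows "0 \<notin> left_prios \<Sigma> rs \<and> 0 \<notin> right_prios \<Sigma> rs"
  using assms(2,3)
proof (induction arbitrary: N)
  case (1 D)
  then show ?case by (simp add: left_prios_def right_prios_def)
next
  case (2 D1 D rs D')
  have pos: "prio \<Sigma> t \<noteq> 0" if "\<Sigma> t = Some (i, a, A)" for t i a A
    using assms(1) that unfolding wf_sig_def prio_eq[of \<Sigma> t, OF that] by fastforce
  from 2(4) show ?case
  proof cases
    case (id_rule r Ds J)
    have "0 \<notin> left_prios \<Sigma> [r] \<and> 0 \<notin> right_prios \<Sigma> [r]"
      using id_rule(2) by cases (auto simp: left_prios_def right_prios_def dest: pos)
    moreover have "drule D = r" "is_deriv \<Sigma> V (N \<union> jdg_chans J) D1"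
      using id_rule 2(1) by auto
    ultimately show ?thesis
      using 2(3) by (auto simp: left_prios_Cons[of _ r rs] right_prios_Cons[of _ r rs])
  next
    case (id_Def d J D0)
    then show ?thesis
      using 2(1,3) by (auto simp: left_prios_Cons[of _ "RDef (pname d)" rs] right_prios_Cons[of _ "RDef (pname d)" rs])
  qed
qed

lemma finite_prios: "finite (left_prios \<Sigma> rs)" "finite (right_prios \<Sigma> rs)"
proof -
  have "left_prios \<Sigma> rs \<subseteq> (\<lambda>r. case r of RMuL t \<Rightarrow> prio \<Sigma> t | RNuL t \<Rightarrow> prio \<Sigma> t) ` set rs"
    by (force simp: left_prios_def image_iff split: rule_name.splits)
  then show "finite (left_prios \<Sigma> rs)" by (rule finite_subset) simp
  have "right_prios \<Sigma> rs \<subseteq> (\<lambda>r. case r of RMuR t \<Rightarrow> prio \<Sigma> t | RNuR t \<Rightarrow> prio \<Sigma> t) ` set rs"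
    by (force simp: right_prios_def image_iff split: rule_name.splits)
  then show "finite (right_prios \<Sigma> rs)" by (rule finite_subset) simp
qed

text \<open>The partial orders relate only distinct variables here, so for a single variable every
  remaining case supplies a strict decrease preceded by equalities.\<close>

lemma precedes_self:
  assumes "precedes \<Sigma> ord X X E L"
  obtains k where "L (Suc k)" "\<And>j. 1 \<le> j \<Longrightarrow> j < Suc k \<Longrightarrow> E j"
proof -
  obtain m where "prefix_lex m E L"
    using assms unfolding precedes_def by blast
  then obtain k where k: "prefix_all k E" "L (Suc k)"
    by (auto simp: prefix_lex_def)
  have "E j" if "1 \<le> j" "j < Suc k" for j
    using k(1) that by (cases j) (auto simp: prefix_all_def)
  with k(2) show ?thesis by (rule that)
qed

theorem theorem9:
  fixes \<Sigma> :: "('l, 't) sig"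
    and \<P> :: "('l, 't, 'x) program"
    and ord :: "nat \<Rightarrow> 'x rel"
  assumes "wf_sig \<Sigma>"
    and "wf_program \<Sigma> \<P>"
    and "order_family \<Sigma> \<P> ord"
    and "locally_valid \<Sigma> ord \<P>"
  shows "fs_guard \<Sigma> \<P>"
  unfolding fs_guard_def
proof (intro allI impI)
  fix D rs D'
  assume "is_cycle \<Sigma> \<P> D rs D'"
  then obtain X where deriv: "is_deriv \<Sigma> (fst \<P>) {} D" and path: "path D rs D'" "rs \<noteq> []"
    and X: "jproc (dconcl D) = Call X" "jproc (dconcl D') = Call X"
    by (auto simp: is_cycle_def)
  \<comment> \<open>The first step of the cycle is split off; as the root is a call, it will turn
    out to unfold the definition of \<open>X\<close>.\<close>
  from path obtain D1 rs' where D1: "D1 |\<in>| dprems D" "path D1 rs' D'" "rs = drule D # rs'"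
    by (auto elim: path.cases)
  from deriv show "left_mu_trace \<Sigma> D rs D' \<or> right_nu_trace \<Sigma> D rs D'"
  proof cases
    case (id_rule r Ds J)
    then show ?thesis using rule_inst_not_Call X by (metis deriv.sel(2))
  next
    case (id_Def d J D0)
    have D: "dconcl D = J" "D1 = D0" "drule D = RDef (pname d)" using id_Def(1) D1(1) by auto
    have d: "pname d = X" using id_Def(3) X D by (simp add: call_of_def)
    have J: "jproc (Jdg (start_left d) {} (pbody d) (start_right d)) = jproc (dconcl D1)"
      using id_Def(4) D by simp
    obtain d' kl kr where d': "d' \<in> fst \<P>" "pname d' = X"
      and kept: "kl \<longrightarrow> left_kept (dconcl D1) (dconcl D')" "kr \<longrightarrow> right_kept (dconcl D1) (dconcl D')"
      and "call_precedes \<Sigma> ord d' d (True \<and> kl) (True \<and> kr) ({} \<union> left_prios \<Sigma> rs') ({} \<union> right_prios \<Sigma> rs')"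
      using path_precedes[OF assms D1(2) id_Def(5)[folded D(2)] id_Def(2)
          checks_start[OF assms(4) id_Def(2)] J jdg_inv_start[OF assms(2) id_Def(2)] X(2)] by blast
    \<comment> \<open>Names determine definitions, so both ends of the cycle have the same
      types.\<close>
    moreover have "d' = d"
      using assms(2) d d' id_Def(2) by (auto simp: wf_program_def dest: inj_onD)
    moreover have prios: "left_prios \<Sigma> rs = left_prios \<Sigma> rs'" "right_prios \<Sigma> rs = right_prios \<Sigma> rs'"
      unfolding D1(3) D(3) left_prios_Cons[of _ "RDef (pname d)" rs'] right_prios_Cons[of _ "RDef (pname d)" rs']
      by simp_all
    ultimately have "precedes \<Sigma> ord (pname d) (pname d)
        (calls_eq \<Sigma> d d kl kr (left_prios \<Sigma> rs) (right_prios \<Sigma> rs))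
        (calls_less \<Sigma> d d kl kr (left_prios \<Sigma> rs) (right_prios \<Sigma> rs))"
      by (simp add: call_precedes_def)
    then obtain k where less: "calls_less \<Sigma> d d kl kr (left_prios \<Sigma> rs) (right_prios \<Sigma> rs) (Suc k)"
      and eq: "\<And>j. 1 \<le> j \<Longrightarrow> j < Suc k \<Longrightarrow> calls_eq \<Sigma> d d kl kr (left_prios \<Sigma> rs) (right_prios \<Sigma> rs) j"
      by (rule precedes_self) blast
    have pos: "0 \<notin> left_prios \<Sigma> rs" "0 \<notin> right_prios \<Sigma> rs"
      using path_prios[OF assms(1) path(1) deriv] by auto
    from less consider
      "side_less \<Sigma> Mu (Suc k) (left_type d) (left_type d) kl (left_prios \<Sigma> rs)"
    | "side_less \<Sigma> Nu (Suc k) (right_type d) (right_type d) kr (right_prios \<Sigma> rs)"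
      by (auto simp: calls_less_def)
    then show ?thesis
    proof cases
      case 1
      have *: "left_type d \<noteq> None \<and> kl \<and> left_prios \<Sigma> rs \<noteq> {} \<and>
          has_polarity \<Sigma> (Min (left_prios \<Sigma> rs)) Mu"
        using side_less_cycle[OF 1 _ pos(1) finite_prios(1)] eq unfolding calls_eq_def by blast
      \<comment> \<open>The flag speaks of the path from \<open>D1\<close>; unfolding the definition
        changes no channel, and \<open>left_type d\<close> being present makes the left side
        nonempty.\<close>
      then have "map_option (fst \<circ> fst) (jleft (dconcl D)) = map_option (fst \<circ> fst) (jleft (dconcl D'))"
        "jleft (dconcl D) \<noteq> None"
        using kept(1) id_Def(3,4) D by (auto simp: left_kept_def left_type_def call_of_def)
      then have "left_traceable (dconcl D) (dconcl D')"
        unfolding left_traceable_def by (cases "jleft (dconcl D)"; cases "jleft (dconcl D')") auto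
      then show ?thesis using * by (simp add: left_mu_trace_def)
    next
      case 2
      have *: "kr \<and> right_prios \<Sigma> rs \<noteq> {} \<and> has_polarity \<Sigma> (Min (right_prios \<Sigma> rs)) Nu"
        using side_less_cycle[OF 2 _ pos(2) finite_prios(2)] eq unfolding calls_eq_def by blast
      then have "right_traceable (dconcl D) (dconcl D')"
        using kept(2) id_Def(4) D by (auto simp: right_kept_def right_traceable_def)
      then show ?thesis using * by (simp add: right_nu_trace_def)
    qed
  qed
qed

end
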